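(* Let $(i,c)$ be an $I$-pointed partially observable $FT(\_)^A$-coalgebra, i.e. $i\colon I\to S$ and $c=\langle\delta,\mathrm{obs}\rangle\colon S\to (FTS)^A\times O$ with $\delta\colon S\to (FTS)^A$ and $\mathrm{obs}\colon S\to O$. Assume: (1) $\tau=\rho\circ F\sigma$ for some monotone algebra $\rho\colon F\Omega\to\Omega$ and some monotone Eilenberg–Moore algebra $\sigma\colon T\Omega\to\Omega$ of $T$ such that $\sigma\circ T\rho=\rho\circ F\sigma\circ\lambda_\Omega$ and $\bot_{TX}=\sigma\circ T(\bot_X)$ for every object $X$; (2) $T\langle \mathrm{id}_S,\mathrm{obs}\rangle\circ\iota_{\mathrm{obs}}=\mathrm{st}\circ\langle\iota_{\mathrm{obs}},\overline{T}_O(\mathrm{obs})\rangle$ as morphisms $\overline{T}_O S_{\mathrm{obs}}\to T(S\times O)$, where $\mathrm{st}\colon TS\times O\to T(S\times O)$ is the strength of $T$. Then $V(i,c)=V(\mathsf{Bel}(i,c))$ as morphisms $I\to\Omega$.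
   Context: Setting. $\mathcal{C}$ is a cartesian closed category with finite products, pullbacks (a choice of pullback squares is fixed) and countable coproducts. For $f\colon X\times Y\to Z$, $f^\dagger\colon X\to Z^Y$ is its adjoint transpose (and for $g\colon X\to Z^Y$, $g^\dagger\colon X\times Y\to Z$). $\mathcal{O}$ is a wide subcategory of $\mathcal{C}$ (containing all objects). $T=(T,\eta,\mu)$ is a strong monad with strength $\mathrm{st}^T_{X,Y}\colon X\times TY\to T(X\times Y)$, $F$ is a strong endofunctor with strength $\mathrm{st}^F_{X,Y}\colon X\times FY\to F(X\times Y)$, and $\lambda\colon TF\Rightarrow FT$ is a distributive law: a natural transformation with $\lambda_X\circ\eta_{FX}=F\eta_X$ and $F\mu_X\circ\lambda_{TX}\circ T\lambda_X=\lambda_X\circ\mu_{FX}$, which moreover satisfies $\lambda_{X\times Y}\circ T(\mathrm{st}^F_{X,Y})\circ\mathrm{st}^T_{X,FY}=F(\mathrm{st}^T_{X,Y})\circ\mathrm{st}^F_{X,TY}\circ(X\times\lambda_Y)$. We write $\mathrm{st}$ for the strengths of $T$, $F$ and of $FT$ (namely $F\mathrm{st}^T\circ\mathrm{st}^F$), applied on either side via the symmetry of $\times$. $A$ (actions) and $I$ are fixed objects. Order. $\Omega$ is an ordered object: every hom-set $\mathcal{C}(X,\Omega)$ is a complete lattice and every precomposition map preserves arbitrary joins; $\bot_X$ is the bottom of $\mathcal{C}(X,\Omega)$. An algebra $\rho\colon G\Omega\to\Omega$ of an endofunctor $G$ is monotone if $g\mapsto\rho\circ Gg$, $\mathcal{C}(X,\Omega)\to\mathcal{C}(GX,\Omega)$,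 is monotone for each $X$. A fixed monotone algebra $\tau\colon FT\Omega\to\Omega$ is given. For an $FT$-coalgebra $e\colon X\to FTX$ define $\Phi_e\colon\mathcal{C}(X,\Omega)\to\mathcal{C}(X,\Omega)$ by $\Phi_e(g)=\tau\circ FTg\circ e$. Sequences. $X^*=\coprod_{n\ge0}X^n$, $X^+=\coprod_{n\ge1}X^n$ (functorial in $X$); $\mathsf{cons}_O\colon O\times O^*\to O^+$ is the canonical isomorphism; $O^*\cong 1+O^+$ induces $A^{O^*}\cong A\times A^{O^+}$; $\mathrm{ev}\colon O\times A^{O^+}\to A^{O^*}$ is the transpose of $O\times A^{O^+}\times O^*\to A$, $(o,h,w)\mapsto h(\mathsf{cons}_O(o,w))$ (i.e. evaluation after $\mathsf{cons}_O$). Schedulers. For $c=\langle\delta,\mathrm{obs}\rangle\colon S\to (FTS)^A\times O$, $\mathsf{Sch}(c)\colon S\times A^{O^*}\to FT(S\times A^{O^*})$ is the composite $S\times A^{O^*}\cong S\times A\times A^{O^+}\xrightarrow{\delta^\dagger\times\mathrm{id}}FTS\times A^{O^+}\xrightarrow{\mathrm{st}}FT(S\times A^{O^+})\xrightarrow{FT\langle\pi_1,\mathrm{ev}\circ(\mathrm{obs}\times\mathrm{id})\rangle}FT(S\times A^{O^*})$. For a pointed coalgebra $(i,c)$ with $i\colon I\to S$, $V(i,c):=\bigvee_{u\colon O^+\to A,\,n\in\mathbb{N}}\Phi^n_{\mathsf{Sch}(c)}(\bot)\circ\langle\mathrm{id}_S,(u\circ\mathsf{cons}_O)^\dagger\circ\mathrm{obs}\rangle\circ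 i\colon I\to\Omega$. Slice monads. For $f\colon X\to O$, the object $\overline{T}_OX_f$ with morphisms $\overline{T}_O(f)\colon\overline{T}_OX_f\to O$ and $\iota_f\colon\overline{T}_OX_f\to TX$ is the chosen pullback of $\eta_O\colon O\to TO$ along $Tf\colon TX\to TO$; this gives an endofunctor $\overline{T}_O$ of the slice category $\mathcal{C}/O$ (on morphisms by universality), which is a monad (induced by the Eilenberg–Moore adjunction sliced over $O$), with unit $\eta^{\overline{T}}_f\colon X\to\overline{T}_OX_f$ the morphism induced by the pair $(\eta_X,f)$. Let $d\colon\mathcal{C}/O\to\mathcal{C}$ be the forgetful functor. For $u\colon O\to O'$ and $f\colon X\to O$, $\theta_{u,f}\colon\overline{T}_OX_f\to\overline{T}_{O'}X_{u\circ f}$ is induced by the pair $(\iota_f,u\circ\overline{T}_O(f))$. Let $\mathsf{flat}^O_f:=\mu_X\circ T\iota_f\colon T(\overline{T}_OX_f)\to TX$. Belief decomposition. A fixed family of natural transformations $\alpha^O\colon Td\Rightarrow Td\overline{T}_O$ (components $\alpha^O_f\colon TX\to T(\overline{T}_OX_f)$), one for each object $O$, with $\mathsf{flat}^O_f\circ\alpha^O_f=\mathrm{id}_{TX}$ and $T(\theta_{u,f})\circ\alpha^O_f=\alpha^{O'}_{u\circ f}$ for every $u\colon O\to O'$ in $\mathcal{O}$. Belief coalgebra. Let $\kappa_Y\colon T(Y^A)\to (TY)^A$ be the transpose of $T(Y^A)\times A\xrightarrow{\mathrm{st}}T(Y^A\times A)\xrightarrow{T\mathrm{ev}}TY$, and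 $\lambda'_X:=(\lambda_X)^A\circ\kappa_{FX}\colon T((FX)^A)\to (FTX)^A$. For $c=\langle\delta,\mathrm{obs}\rangle$ set $c^{\mathsf{Bel}}:=(F\alpha^O_{\mathrm{obs}})^A\circ(F\mu_S)^A\circ\lambda'_{TS}\circ T\delta\circ\iota_{\mathrm{obs}}\colon\overline{T}_OS_{\mathrm{obs}}\to (FT(\overline{T}_OS_{\mathrm{obs}}))^A$ and $\mathsf{Bel}(i,c):=(\eta^{\overline{T}}_{\mathrm{obs}}\circ i,\ \langle c^{\mathsf{Bel}},\overline{T}_O(\mathrm{obs})\rangle)$, an $I$-pointed partially observable coalgebra with state object $\overline{T}_OS_{\mathrm{obs}}$ and observation object $O$. *)

theory Defs
  imports "HOL-Algebra.Complete_Lattice"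
begin

section \<open>Categories, functors, natural transformations\<close>

record ('o, 'm) category =
  Obj :: "'o set"
  Arr :: "'m set"
  Dom :: "'m \<Rightarrow> 'o"
  Cod :: "'m \<Rightarrow> 'o"
  Id :: "'o \<Rightarrow> 'm"
  Comp :: "'m \<Rightarrow> 'm \<Rightarrow> 'm"  (infixr "\<cdot>\<index>" 70)

definition Hom :: "('o, 'm, 'x) category_scheme \<Rightarrow> 'o \<Rightarrow> 'o \<Rightarrow> 'm set" where
  "Hom C X Y = {f \<in> Arr C. Dom C f = X \<and> Cod C f = Y}"

locale category =
  fixes C :: "('o, 'm, 'x) category_scheme" (structure)
  assumes Dom_Obj: "f \<in> Arr C \<Longrightarrow> Dom C f \<in> Obj C"
    and Cod_Obj: "f \<in> Arr C \<Longrightarrow> Cod C f \<in> Obj C"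
    and Id_Hom: "X \<in> Obj C \<Longrightarrow> Id C X \<in> Hom C X X"
    and Comp_Hom: "\<lbrakk>f \<in> Hom C X Y; g \<in> Hom C Y Z\<rbrakk> \<Longrightarrow> g \<cdot> f \<in> Hom C X Z"
    and Id_left: "f \<in> Hom C X Y \<Longrightarrow> Id C Y \<cdot> f = f"
    and Id_right: "f \<in> Hom C X Y \<Longrightarrow> f \<cdot> Id C X = f"
    and Comp_assoc:
      "\<lbrakk>f \<in> Hom C W X; g \<in> Hom C X Y; h \<in> Hom C Y Z\<rbrakk> \<Longrightarrow> (h \<cdot> g) \<cdot> f = h \<cdot> (g \<cdot> f)"

definition wide_subcategory :: "('o, 'm, 'x) category_scheme \<Rightarrow> 'm set \<Rightarrow> bool" where
  "wide_subcategory C W \<longleftrightarrow>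
     W \<subseteq> Arr C \<and> (\<forall>X\<in>Obj C. Id C X \<in> W) \<and>
     (\<forall>f\<in>W. \<forall>g\<in>W. Dom C g = Cod C f \<longrightarrow> g \<cdot>\<^bsub>C\<^esub> f \<in> W)"

record ('o1, 'm1, 'o2, 'm2) cat_functor =
  fobj :: "'o1 \<Rightarrow> 'o2"
  fmap :: "'m1 \<Rightarrow> 'm2"

definition is_functor ::
  "('o1, 'm1, 'x) category_scheme \<Rightarrow> ('o2, 'm2, 'y) category_scheme
    \<Rightarrow> ('o1, 'm1, 'o2, 'm2) cat_functor \<Rightarrow> bool" where
  "is_functor C D G \<longleftrightarrow>
     (\<forall>X\<in>Obj C. fobj G X \<in> Obj D) \<and>
     (\<forall>X Y. \<forall>f\<in>Hom C X Y. fmap G f \<in> Hom D (fobj G X) (fobj G Y)) \<and>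
     (\<forall>X\<in>Obj C. fmap G (Id C X) = Id D (fobj G X)) \<and>
     (\<forall>X Y Z. \<forall>f\<in>Hom C X Y. \<forall>g\<in>Hom C Y Z.
        fmap G (g \<cdot>\<^bsub>C\<^esub> f) = fmap G g \<cdot>\<^bsub>D\<^esub> fmap G f)"

definition id_functor :: "('o, 'm, 'o, 'm) cat_functor" where
  "id_functor = \<lparr>fobj = (\<lambda>X. X), fmap = (\<lambda>f. f)\<rparr>"

definition fcomp ::
  "('o2, 'm2, 'o3, 'm3) cat_functor \<Rightarrow> ('o1, 'm1, 'o2, 'm2) cat_functor
    \<Rightarrow> ('o1, 'm1, 'o3, 'm3) cat_functor"  (infixr "\<circ>\<^sub>F" 75) where
  "G \<circ>\<^sub>F H = \<lparr>fobj = (\<lambda>X. fobj G (fobj H X)), fmap = (\<lambda>f. fmap G (fmap H f))\<rparr>"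

text \<open>Functoriality of \<open>G\<close> and \<open>H\<close> is not part of this predicate.\<close>

definition natural ::
  "('o1, 'm1, 'x) category_scheme \<Rightarrow> ('o2, 'm2, 'y) category_scheme
    \<Rightarrow> ('o1, 'm1, 'o2, 'm2) cat_functor \<Rightarrow> ('o1, 'm1, 'o2, 'm2) cat_functor
    \<Rightarrow> ('o1 \<Rightarrow> 'm2) \<Rightarrow> bool" where
  "natural C D G H a \<longleftrightarrow>
     (\<forall>X\<in>Obj C. a X \<in> Hom D (fobj G X) (fobj H X)) \<and>
     (\<forall>X Y. \<forall>f\<in>Hom C X Y. fmap H f \<cdot>\<^bsub>D\<^esub> a X = a Y \<cdot>\<^bsub>D\<^esub> fmap G f)"

text \<open>Objects of the slice over \<open>Z\<close> are the arrows with codomain \<open>Z\<close>; an arrow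
  \<open>f \<rightarrow> g\<close> is a triple \<open>(f, h, g)\<close> with \<open>g \<cdot> h = f\<close>.\<close>

definition slice :: "('o, 'm, 'x) category_scheme \<Rightarrow> 'o \<Rightarrow> ('m, 'm \<times> 'm \<times> 'm) category" where
  "slice C Z =
     \<lparr>Obj = {f \<in> Arr C. Cod C f = Z},
      Arr = {(f, h, g). f \<in> Arr C \<and> Cod C f = Z \<and> g \<in> Arr C \<and> Cod C g = Z \<and>
                        h \<in> Hom C (Dom C f) (Dom C g) \<and> g \<cdot>\<^bsub>C\<^esub> h = f},
      Dom = (\<lambda>(f, h, g). f),
      Cod = (\<lambda>(f, h, g). g),
      Id = (\<lambda>f. (f, Id C (Dom C f), f)),
      Comp = (\<lambda>(f', k, g) (f, h, _). (f, k \<cdot>\<^bsub>C\<^esub> h, g))\<rparr>"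

definition slice_forget ::
  "('o, 'm, 'x) category_scheme \<Rightarrow> ('m, 'm \<times> 'm \<times> 'm, 'o, 'm) cat_functor" where
  "slice_forget C = \<lparr>fobj = Dom C, fmap = (\<lambda>(f, h, g). h)\<rparr>"


section \<open>Cartesian closed categories with pullbacks and countable coproducts\<close>

definition is_terminal :: "('o, 'm, 'x) category_scheme \<Rightarrow> 'o \<Rightarrow> bool" where
  "is_terminal C Z \<longleftrightarrow> Z \<in> Obj C \<and> (\<forall>X\<in>Obj C. \<exists>!h. h \<in> Hom C X Z)"

definition is_product ::
  "('o, 'm, 'x) category_scheme \<Rightarrow> 'o \<Rightarrow> 'o \<Rightarrow> 'o \<Rightarrow> 'm \<Rightarrow> 'm \<Rightarrow> bool" where
  "is_product C X Y P p q \<longleftrightarrow>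
     P \<in> Obj C \<and> p \<in> Hom C P X \<and> q \<in> Hom C P Y \<and>
     (\<forall>W. \<forall>f\<in>Hom C W X. \<forall>g\<in>Hom C W Y.
        \<exists>!h. h \<in> Hom C W P \<and> p \<cdot>\<^bsub>C\<^esub> h = f \<and> q \<cdot>\<^bsub>C\<^esub> h = g)"

definition is_pullback ::
  "('o, 'm, 'x) category_scheme \<Rightarrow> 'm \<Rightarrow> 'm \<Rightarrow> 'o \<Rightarrow> 'm \<Rightarrow> 'm \<Rightarrow> bool" where
  "is_pullback C f g P p q \<longleftrightarrow>
     P \<in> Obj C \<and> p \<in> Hom C P (Dom C f) \<and> q \<in> Hom C P (Dom C g) \<and>
     f \<cdot>\<^bsub>C\<^esub> p = g \<cdot>\<^bsub>C\<^esub> q \<and>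
     (\<forall>W. \<forall>a\<in>Hom C W (Dom C f). \<forall>b\<in>Hom C W (Dom C g).
        f \<cdot>\<^bsub>C\<^esub> a = g \<cdot>\<^bsub>C\<^esub> b \<longrightarrow>
        (\<exists>!h. h \<in> Hom C W P \<and> p \<cdot>\<^bsub>C\<^esub> h = a \<and> q \<cdot>\<^bsub>C\<^esub> h = b))"

definition is_coproduct ::
  "('o, 'm, 'x) category_scheme \<Rightarrow> 'i set \<Rightarrow> ('i \<Rightarrow> 'o) \<Rightarrow> 'o \<Rightarrow> ('i \<Rightarrow> 'm) \<Rightarrow> bool" where
  "is_coproduct C J X P inc \<longleftrightarrow>
     P \<in> Obj C \<and> (\<forall>j\<in>J. inc j \<in> Hom C (X j) P) \<and>
     (\<forall>W\<in>Obj C. \<forall>f. (\<forall>j\<in>J. f j \<in> Hom C (X j) W) \<longrightarrow>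
        (\<exists>!h. h \<in> Hom C P W \<and> (\<forall>j\<in>J. h \<cdot>\<^bsub>C\<^esub> inc j = f j)))"

text \<open>\<open>Exp C Z Y\<close> is the exponential \<open>Z\<^sup>Y\<close> and \<open>Ev C Z Y\<close> its evaluation
  \<open>Z\<^sup>Y \<times> Y \<rightarrow> Z\<close>. \<open>Pb1 C f g\<close> and \<open>Pb2 C f g\<close> go from the pullback to the domains of
  \<open>f\<close> and \<open>g\<close>. Countable coproducts are indexed by arbitrary subsets of the natural numbers.\<close>

record ('o, 'm) ccc = "('o, 'm) category" +
  One :: 'o
  Prod :: "'o \<Rightarrow> 'o \<Rightarrow> 'o"  (infixr "\<otimes>\<index>" 80)
  P1 :: "'o \<Rightarrow> 'o \<Rightarrow> 'm"
  P2 :: "'o \<Rightarrow> 'o \<Rightarrow> 'm"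
  Exp :: "'o \<Rightarrow> 'o \<Rightarrow> 'o"
  Ev :: "'o \<Rightarrow> 'o \<Rightarrow> 'm"
  Pb :: "'m \<Rightarrow> 'm \<Rightarrow> 'o"
  Pb1 :: "'m \<Rightarrow> 'm \<Rightarrow> 'm"
  Pb2 :: "'m \<Rightarrow> 'm \<Rightarrow> 'm"
  Coprod :: "nat set \<Rightarrow> (nat \<Rightarrow> 'o) \<Rightarrow> 'o"
  Inj :: "nat set \<Rightarrow> (nat \<Rightarrow> 'o) \<Rightarrow> nat \<Rightarrow> 'm"

context
  fixes C :: "('o, 'm, 'x) ccc_scheme" (structure)
begin

definition bang :: "'o \<Rightarrow> 'm" where
  "bang X = (THE h. h \<in> Hom C X (One C))"

definition pair :: "'m \<Rightarrow> 'm \<Rightarrow> 'm" where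
  "pair f g = (THE h. h \<in> Hom C (Dom C f) (Cod C f \<otimes> Cod C g) \<and>
                      P1 C (Cod C f) (Cod C g) \<cdot> h = f \<and>
                      P2 C (Cod C f) (Cod C g) \<cdot> h = g)"

definition cross :: "'m \<Rightarrow> 'm \<Rightarrow> 'm" where
  "cross f g = pair (f \<cdot> P1 C (Dom C f) (Dom C g)) (g \<cdot> P2 C (Dom C f) (Dom C g))"

definition swap :: "'o \<Rightarrow> 'o \<Rightarrow> 'm" where
  "swap X Y = pair (P2 C X Y) (P1 C X Y)"

text \<open>\<open>assocr\<close> is \<open>(X \<times> Y) \<times> Z \<rightarrow> X \<times> (Y \<times> Z)\<close> and \<open>assocl\<close> is its inverse.\<close>

definition assocr :: "'o \<Rightarrow> 'o \<Rightarrow> 'o \<Rightarrow> 'm" where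
  "assocr X Y Z =
     pair (P1 C X Y \<cdot> P1 C (X \<otimes> Y) Z)
          (pair (P2 C X Y \<cdot> P1 C (X \<otimes> Y) Z) (P2 C (X \<otimes> Y) Z))"

definition assocl :: "'o \<Rightarrow> 'o \<Rightarrow> 'o \<Rightarrow> 'm" where
  "assocl X Y Z =
     pair (pair (P1 C X (Y \<otimes> Z)) (P1 C Y Z \<cdot> P2 C X (Y \<otimes> Z)))
          (P2 C Y Z \<cdot> P2 C X (Y \<otimes> Z))"

definition is_exponential :: "'o \<Rightarrow> 'o \<Rightarrow> 'o \<Rightarrow> 'm \<Rightarrow> bool" where
  "is_exponential Z Y E ev \<longleftrightarrow>
     E \<in> Obj C \<and> ev \<in> Hom C (E \<otimes> Y) Z \<and>
     (\<forall>X\<in>Obj C. \<forall>f\<in>Hom C (X \<otimes> Y) Z. \<exists>!h. h \<in> Hom C X E \<and> ev \<cdot> cross h (Id C Y) = f)"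

text \<open>The two directions of the transpose \<open>\<dagger>\<close>: \<open>curry X Y f\<close> is the transpose of
  \<open>f : X \<times> Y \<rightarrow> Z\<close>, and \<open>uncurry Y Z g\<close> that of \<open>g : X \<rightarrow> Z\<^sup>Y\<close>. The objects \<open>X\<close>, \<open>Y\<close>, \<open>Z\<close> have
  to be supplied since they cannot be recovered from \<open>X \<times> Y\<close> or \<open>Z\<^sup>Y\<close>.\<close>

definition curry :: "'o \<Rightarrow> 'o \<Rightarrow> 'm \<Rightarrow> 'm" where
  "curry X Y f = (THE h. h \<in> Hom C X (Exp C (Cod C f) Y) \<and>
                         Ev C (Cod C f) Y \<cdot> cross h (Id C Y) = f)"

definition uncurry :: "'o \<Rightarrow> 'o \<Rightarrow> 'm \<Rightarrow> 'm" where
  "uncurry Y Z g = Ev C Z Y \<cdot> cross g (Id C Y)"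

definition exp_map :: "'o \<Rightarrow> 'm \<Rightarrow> 'm" where
  "exp_map A f = curry (Exp C (Dom C f) A) A (f \<cdot> Ev C (Dom C f) A)"

definition into_pb :: "'m \<Rightarrow> 'm \<Rightarrow> 'm \<Rightarrow> 'm \<Rightarrow> 'm" where
  "into_pb f g a b =
     (THE h. h \<in> Hom C (Dom C a) (Pb C f g) \<and> Pb1 C f g \<cdot> h = a \<and> Pb2 C f g \<cdot> h = b)"

primrec pow_obj :: "'o \<Rightarrow> nat \<Rightarrow> 'o" where
  "pow_obj X 0 = One C"
| "pow_obj X (Suc n) = X \<otimes> pow_obj X n"

definition star_obj :: "'o \<Rightarrow> 'o" where
  "star_obj X = Coprod C UNIV (pow_obj X)"

definition plus_obj :: "'o \<Rightarrow> 'o" where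
  "plus_obj X = Coprod C {1..} (pow_obj X)"

text \<open>Since \<open>X \<times> -\<close> preserves coproducts in a cartesian closed category, \<open>X \<times> X\<^sup>*\<close> is the
  coproduct of the objects \<open>X \<times> X\<^sup>n = X\<^sup>n\<^sup>+\<^sup>1\<close>, so the following equations determine \<open>cons X\<close>.\<close>

definition cons :: "'o \<Rightarrow> 'm" where
  "cons X = (THE k. k \<in> Hom C (X \<otimes> star_obj X) (plus_obj X) \<and>
                    (\<forall>n. k \<cdot> cross (Id C X) (Inj C UNIV (pow_obj X) n)
                         = Inj C {1..} (pow_obj X) (Suc n)))"

definition nil :: "'o \<Rightarrow> 'm" where
  "nil X = Inj C UNIV (pow_obj X) 0"

definition plus_incl :: "'o \<Rightarrow> 'm" where
  "plus_incl X = (THE j. j \<in> Hom C (plus_obj X) (star_obj X) \<and>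
                         (\<forall>n\<ge>1. j \<cdot> Inj C {1..} (pow_obj X) n = Inj C UNIV (pow_obj X) n))"

text \<open>The isomorphism \<open>A\<^sup>X\<^sup>* \<rightarrow> A \<times> A\<^sup>X\<^sup>+\<close> induced by \<open>X\<^sup>* \<cong> 1 + X\<^sup>+\<close>: it sends \<open>h\<close> to its value at
  the empty word and its restriction to \<open>X\<^sup>+\<close>.\<close>

definition split_exp :: "'o \<Rightarrow> 'o \<Rightarrow> 'm" where
  "split_exp A X =
     (let H = Exp C A (star_obj X) in
      pair (Ev C A (star_obj X) \<cdot> pair (Id C H) (nil X \<cdot> bang H))
           (curry H (plus_obj X) (Ev C A (star_obj X) \<cdot> cross (Id C H) (plus_incl X))))"

text \<open>\<open>ev_cons A X : X \<times> A\<^sup>X\<^sup>+ \<rightarrow> A\<^sup>X\<^sup>*\<close> is the transpose of \<open>((x, h), w) \<mapsto> h (cons (x, w))\<close>.\<close>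

definition ev_cons :: "'o \<Rightarrow> 'o \<Rightarrow> 'm" where
  "ev_cons A X =
     (let H = Exp C A (plus_obj X); W = star_obj X in
      curry (X \<otimes> H) W
        (Ev C A (plus_obj X) \<cdot>
           pair (P2 C X H \<cdot> P1 C (X \<otimes> H) W)
                (cons X \<cdot> pair (P1 C X H \<cdot> P1 C (X \<otimes> H) W) (P2 C (X \<otimes> H) W))))"

end

locale ccc = category C for C :: "('o, 'm, 'x) ccc_scheme" (structure) +
  assumes terminal: "is_terminal C (One C)"
    and products:
      "\<lbrakk>X \<in> Obj C; Y \<in> Obj C\<rbrakk> \<Longrightarrow> is_product C X Y (X \<otimes> Y) (P1 C X Y) (P2 C X Y)"
    and exponentials:
      "\<lbrakk>Z \<in> Obj C; Y \<in> Obj C\<rbrakk> \<Longrightarrow> is_exponential C Z Y (Exp C Z Y) (Ev C Z Y)"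
    and pullbacks:
      "\<lbrakk>f \<in> Arr C; g \<in> Arr C; Cod C f = Cod C g\<rbrakk>
        \<Longrightarrow> is_pullback C f g (Pb C f g) (Pb1 C f g) (Pb2 C f g)"
    and countable_coproducts:
      "(\<And>j. j \<in> J \<Longrightarrow> D j \<in> Obj C) \<Longrightarrow> is_coproduct C J D (Coprod C J D) (Inj C J D)"


section \<open>Strong functors, strong monads, distributive laws\<close>

type_synonym ('o, 'm) endo = "('o, 'm, 'o, 'm) cat_functor"

context
  fixes C :: "('o, 'm, 'x) ccc_scheme" (structure)
begin

definition is_strength :: "('o, 'm) endo \<Rightarrow> ('o \<Rightarrow> 'o \<Rightarrow> 'm) \<Rightarrow> bool" where
  "is_strength G st \<longleftrightarrow>
     (\<forall>X\<in>Obj C. \<forall>Y\<in>Obj C. st X Y \<in> Hom C (X \<otimes> fobj G Y) (fobj G (X \<otimes> Y))) \<and>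
     (\<forall>X X' Y Y'. \<forall>f\<in>Hom C X X'. \<forall>g\<in>Hom C Y Y'.
        fmap G (cross C f g) \<cdot> st X Y = st X' Y' \<cdot> cross C f (fmap G g)) \<and>
     (\<forall>Y\<in>Obj C. fmap G (P2 C (One C) Y) \<cdot> st (One C) Y = P2 C (One C) (fobj G Y)) \<and>
     (\<forall>X\<in>Obj C. \<forall>Y\<in>Obj C. \<forall>Z\<in>Obj C.
        fmap G (assocr C X Y Z) \<cdot> st (X \<otimes> Y) Z
        = st X (Y \<otimes> Z) \<cdot> cross C (Id C X) (st Y Z) \<cdot> assocr C X Y (fobj G Z))"

definition strong_endofunctor :: "('o, 'm) endo \<Rightarrow> ('o \<Rightarrow> 'o \<Rightarrow> 'm) \<Rightarrow> bool" where
  "strong_endofunctor G st \<longleftrightarrow> is_functor C C G \<and> is_strength G st"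

definition is_monad :: "('o, 'm) endo \<Rightarrow> ('o \<Rightarrow> 'm) \<Rightarrow> ('o \<Rightarrow> 'm) \<Rightarrow> bool" where
  "is_monad T \<eta> \<mu> \<longleftrightarrow>
     is_functor C C T \<and> natural C C id_functor T \<eta> \<and> natural C C (T \<circ>\<^sub>F T) T \<mu> \<and>
     (\<forall>X\<in>Obj C. \<mu> X \<cdot> \<eta> (fobj T X) = Id C (fobj T X) \<and>
                 \<mu> X \<cdot> fmap T (\<eta> X) = Id C (fobj T X) \<and>
                 \<mu> X \<cdot> \<mu> (fobj T X) = \<mu> X \<cdot> fmap T (\<mu> X))"

definition strong_monad ::
  "('o, 'm) endo \<Rightarrow> ('o \<Rightarrow> 'm) \<Rightarrow> ('o \<Rightarrow> 'm) \<Rightarrow> ('o \<Rightarrow> 'o \<Rightarrow> 'm) \<Rightarrow> bool" where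
  "strong_monad T \<eta> \<mu> st \<longleftrightarrow>
     is_monad T \<eta> \<mu> \<and> is_strength T st \<and>
     (\<forall>X\<in>Obj C. \<forall>Y\<in>Obj C.
        st X Y \<cdot> cross C (Id C X) (\<eta> Y) = \<eta> (X \<otimes> Y) \<and>
        st X Y \<cdot> cross C (Id C X) (\<mu> Y)
          = \<mu> (X \<otimes> Y) \<cdot> fmap T (st X Y) \<cdot> st X (fobj T Y))"

definition distributive_law ::
  "('o, 'm) endo \<Rightarrow> ('o \<Rightarrow> 'm) \<Rightarrow> ('o \<Rightarrow> 'm) \<Rightarrow> ('o, 'm) endo \<Rightarrow> ('o \<Rightarrow> 'm) \<Rightarrow> bool" where
  "distributive_law T \<eta> \<mu> F dl \<longleftrightarrow>
     natural C C (T \<circ>\<^sub>F F) (F \<circ>\<^sub>F T) dl \<and>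
     (\<forall>X\<in>Obj C. dl X \<cdot> \<eta> (fobj F X) = fmap F (\<eta> X) \<and>
                 fmap F (\<mu> X) \<cdot> dl (fobj T X) \<cdot> fmap T (dl X) = dl X \<cdot> \<mu> (fobj F X))"

definition strength_compatible ::
  "('o, 'm) endo \<Rightarrow> ('o \<Rightarrow> 'o \<Rightarrow> 'm) \<Rightarrow> ('o, 'm) endo \<Rightarrow> ('o \<Rightarrow> 'o \<Rightarrow> 'm) \<Rightarrow> ('o \<Rightarrow> 'm) \<Rightarrow> bool"
where
  "strength_compatible T stT F stF dl \<longleftrightarrow>
     (\<forall>X\<in>Obj C. \<forall>Y\<in>Obj C.
        dl (X \<otimes> Y) \<cdot> fmap T (stF X Y) \<cdot> stT X (fobj F Y)
        = fmap F (stT X Y) \<cdot> stF X (fobj T Y) \<cdot> cross C (Id C X) (dl Y))"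

text \<open>The strength on the other side, \<open>GX \<times> Y \<rightarrow> G (X \<times> Y)\<close>.\<close>

definition rstrength :: "('o, 'm) endo \<Rightarrow> ('o \<Rightarrow> 'o \<Rightarrow> 'm) \<Rightarrow> 'o \<Rightarrow> 'o \<Rightarrow> 'm" where
  "rstrength G st X Y = fmap G (swap C Y X) \<cdot> st Y X \<cdot> swap C (fobj G X) Y"

definition EM_algebra :: "('o, 'm) endo \<Rightarrow> ('o \<Rightarrow> 'm) \<Rightarrow> ('o \<Rightarrow> 'm) \<Rightarrow> 'o \<Rightarrow> 'm \<Rightarrow> bool" where
  "EM_algebra T \<eta> \<mu> X \<sigma> \<longleftrightarrow>
     \<sigma> \<in> Hom C (fobj T X) X \<and> \<sigma> \<cdot> \<eta> X = Id C X \<and> \<sigma> \<cdot> \<mu> X = \<sigma> \<cdot> fmap T \<sigma>"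

end


section \<open>Ordered objects\<close>

text \<open>The orders on all the hom-sets into \<open>\<Omega>\<close> are given by one relation on arrows; as hom-sets
  are pairwise disjoint, this amounts to one order for each of them.\<close>

definition hom_order ::
  "('o, 'm, 'x) category_scheme \<Rightarrow> 'o \<Rightarrow> ('m \<Rightarrow> 'm \<Rightarrow> bool) \<Rightarrow> 'o \<Rightarrow> 'm gorder" where
  "hom_order C \<Omega> r X = \<lparr>carrier = Hom C X \<Omega>, eq = (=), gorder.le = r\<rparr>"

definition ordered_object ::
  "('o, 'm, 'x) category_scheme \<Rightarrow> 'o \<Rightarrow> ('m \<Rightarrow> 'm \<Rightarrow> bool) \<Rightarrow> bool" where
  "ordered_object C \<Omega> r \<longleftrightarrow>
     \<Omega> \<in> Obj C \<and>
     (\<forall>X\<in>Obj C. complete_lattice (hom_order C \<Omega> r X)) \<and>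
     (\<forall>X Y. \<forall>h\<in>Hom C Y X. \<forall>G. G \<subseteq> Hom C X \<Omega> \<longrightarrow>
        (\<Squnion>\<^bsub>hom_order C \<Omega> r X\<^esub> G) \<cdot>\<^bsub>C\<^esub> h
        = \<Squnion>\<^bsub>hom_order C \<Omega> r Y\<^esub> ((\<lambda>g. g \<cdot>\<^bsub>C\<^esub> h) ` G))"

definition monotone_algebra ::
  "('o, 'm, 'x) category_scheme \<Rightarrow> 'o \<Rightarrow> ('m \<Rightarrow> 'm \<Rightarrow> bool) \<Rightarrow> ('o, 'm) endo \<Rightarrow> 'm \<Rightarrow> bool" where
  "monotone_algebra C \<Omega> r G \<rho> \<longleftrightarrow>
     \<rho> \<in> Hom C (fobj G \<Omega>) \<Omega> \<and>
     (\<forall>X\<in>Obj C. \<forall>g\<in>Hom C X \<Omega>. \<forall>g'\<in>Hom C X \<Omega>.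
        r g g' \<longrightarrow> r (\<rho> \<cdot>\<^bsub>C\<^esub> fmap G g) (\<rho> \<cdot>\<^bsub>C\<^esub> fmap G g'))"


section \<open>The setting\<close>

record ('o, 'm) setting = "('o, 'm) ccc" +
  Wide :: "'m set"
  Tf :: "('o, 'm) endo"
  eta :: "'o \<Rightarrow> 'm"
  mu :: "'o \<Rightarrow> 'm"
  stT :: "'o \<Rightarrow> 'o \<Rightarrow> 'm"
  Ff :: "('o, 'm) endo"
  stF :: "'o \<Rightarrow> 'o \<Rightarrow> 'm"
  dlaw :: "'o \<Rightarrow> 'm"
  Act :: 'o
  Init :: 'o
  Omega :: 'o
  leq :: "'m \<Rightarrow> 'm \<Rightarrow> bool"
  tau :: 'm
  alpha :: "'o \<Rightarrow> 'm \<Rightarrow> 'm"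

context
  fixes E :: "('o, 'm) setting" (structure)
begin

definition FT :: "('o, 'm) endo" where
  "FT = Ff E \<circ>\<^sub>F Tf E"

definition stFT :: "'o \<Rightarrow> 'o \<Rightarrow> 'm" where
  "stFT X Y = fmap (Ff E) (stT E X Y) \<cdot> stF E X (fobj (Tf E) Y)"

definition hom_lattice :: "'o \<Rightarrow> 'm gorder" where
  "hom_lattice X = hom_order E (Omega E) (leq E) X"

definition bot_arr :: "'o \<Rightarrow> 'm" where
  "bot_arr X = \<bottom>\<^bsub>hom_lattice X\<^esub>"

subsection \<open>The slice monads\<close>

text \<open>\<open>Tbar_obj f\<close> is the object, \<open>Tbar_arr f\<close> its structure morphism to the codomain of \<open>f\<close>;
  the base object is always the codomain of \<open>f\<close>.\<close>

definition Tbar_obj :: "'m \<Rightarrow> 'o" where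
  "Tbar_obj f = Pb E (fmap (Tf E) f) (eta E (Cod E f))"

definition iota :: "'m \<Rightarrow> 'm" where
  "iota f = Pb1 E (fmap (Tf E) f) (eta E (Cod E f))"

definition Tbar_arr :: "'m \<Rightarrow> 'm" where
  "Tbar_arr f = Pb2 E (fmap (Tf E) f) (eta E (Cod E f))"

definition into_Tbar :: "'m \<Rightarrow> 'm \<Rightarrow> 'm \<Rightarrow> 'm" where
  "into_Tbar f a b = into_pb E (fmap (Tf E) f) (eta E (Cod E f)) a b"

definition Tbar :: "('m, 'm \<times> 'm \<times> 'm, 'm, 'm \<times> 'm \<times> 'm) cat_functor" where
  "Tbar = \<lparr>fobj = Tbar_arr,
           fmap = (\<lambda>(f, h, g).
             (Tbar_arr f, into_Tbar g (fmap (Tf E) h \<cdot> iota f) (Tbar_arr f), Tbar_arr g))\<rparr>"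

definition eta_bar :: "'m \<Rightarrow> 'm" where
  "eta_bar f = into_Tbar f (eta E (Dom E f)) f"

definition theta :: "'m \<Rightarrow> 'm \<Rightarrow> 'm" where
  "theta u f = into_Tbar (u \<cdot> f) (iota f) (u \<cdot> Tbar_arr f)"

definition flat :: "'m \<Rightarrow> 'm" where
  "flat f = mu E (Dom E f) \<cdot> fmap (Tf E) (iota f)"

definition belief_decomposition :: "('o \<Rightarrow> 'm \<Rightarrow> 'm) \<Rightarrow> bool" where
  "belief_decomposition a \<longleftrightarrow>
     (\<forall>Z\<in>Obj E. natural (slice E Z) E
        (Tf E \<circ>\<^sub>F slice_forget E) (Tf E \<circ>\<^sub>F slice_forget E \<circ>\<^sub>F Tbar) (a Z)) \<and>
     (\<forall>X Z. \<forall>f\<in>Hom E X Z. flat f \<cdot> a Z f = Id E (fobj (Tf E) X)) \<and>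
     (\<forall>X Z Z'. \<forall>f\<in>Hom E X Z. \<forall>u\<in>Hom E Z Z' \<inter> Wide E.
        fmap (Tf E) (theta u f) \<cdot> a Z f = a Z' (u \<cdot> f))"

end

locale setting = ccc E for E :: "('o, 'm) setting" (structure) +
  assumes wide: "wide_subcategory E (Wide E)"
    and monad: "strong_monad E (Tf E) (eta E) (mu E) (stT E)"
    and functor_F: "strong_endofunctor E (Ff E) (stF E)"
    and dlaw: "distributive_law E (Tf E) (eta E) (mu E) (Ff E) (dlaw E)"
    and dlaw_strength: "strength_compatible E (Tf E) (stT E) (Ff E) (stF E) (dlaw E)"
    and Act: "Act E \<in> Obj E"
    and Init: "Init E \<in> Obj E"
    and Omega: "ordered_object E (Omega E) (leq E)"
    and tau: "monotone_algebra E (Omega E) (leq E) (FT E) (tau E)"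
    and alpha: "belief_decomposition E (alpha E)"


section \<open>Pointed partially observable coalgebras\<close>

text \<open>A pointed coalgebra \<open>(i, c)\<close> is recorded with its state object \<open>S\<close> and observation object
  \<open>O\<close>, because \<open>O\<close> cannot be recovered from the codomain \<open>(FTS)\<^sup>A \<times> O\<close> of \<open>c\<close>.\<close>

record ('o, 'm) pcoalg =
  State :: 'o
  Obs :: 'o
  point :: 'm
  struct :: 'm

context
  fixes E :: "('o, 'm) setting" (structure)
begin

definition is_pcoalg :: "('o, 'm) pcoalg \<Rightarrow> bool" where
  "is_pcoalg K \<longleftrightarrow>
     State K \<in> Obj E \<and> Obs K \<in> Obj E \<and>
     point K \<in> Hom E (Init E) (State K) \<and>
     struct K \<in> Hom E (State K) (Exp E (fobj (FT E) (State K)) (Act E) \<otimes> Obs K)"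

definition delta :: "('o, 'm) pcoalg \<Rightarrow> 'm" where
  "delta K = P1 E (Exp E (fobj (FT E) (State K)) (Act E)) (Obs K) \<cdot> struct K"

definition obs :: "('o, 'm) pcoalg \<Rightarrow> 'm" where
  "obs K = P2 E (Exp E (fobj (FT E) (State K)) (Act E)) (Obs K) \<cdot> struct K"

definition Phi :: "'m \<Rightarrow> 'm \<Rightarrow> 'm" where
  "Phi e g = tau E \<cdot> fmap (FT E) g \<cdot> e"

definition Sch :: "('o, 'm) pcoalg \<Rightarrow> 'm" where
  "Sch K =
     (let S = State K; A = Act E; H = Exp E A (plus_obj E (Obs K)) in
      fmap (FT E) (pair E (P1 E S H) (ev_cons E A (Obs K) \<cdot> cross E (obs K) (Id E H))) \<cdot>
      rstrength E (FT E) (stFT E) S H \<cdot>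
      cross E (uncurry E A (fobj (FT E) S) (delta K)) (Id E H) \<cdot>
      assocl E S A H \<cdot>
      cross E (Id E S) (split_exp E A (Obs K)))"

definition value_of :: "('o, 'm) pcoalg \<Rightarrow> 'm" where
  "value_of K =
     (let S = State K; Ob = Obs K; W = star_obj E Ob in
      \<Squnion>\<^bsub>hom_lattice E (Init E)\<^esub>
        {(Phi (Sch K) ^^ n) (bot_arr E (S \<otimes> Exp E (Act E) W)) \<cdot>
           pair E (Id E S) (curry E Ob W (u \<cdot> cons E Ob) \<cdot> obs K) \<cdot> point K
         | u n. u \<in> Hom E (plus_obj E Ob) (Act E)})"

subsection \<open>The belief coalgebra\<close>

definition kappa :: "'o \<Rightarrow> 'm" where
  "kappa Y =
     (let A = Act E in
      curry E (fobj (Tf E) (Exp E Y A)) A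
        (fmap (Tf E) (Ev E Y A) \<cdot> rstrength E (Tf E) (stT E) (Exp E Y A) A))"

definition dlaw' :: "'o \<Rightarrow> 'm" where
  "dlaw' X = exp_map E (Act E) (dlaw E X) \<cdot> kappa (fobj (Ff E) X)"

definition bel_trans :: "('o, 'm) pcoalg \<Rightarrow> 'm" where
  "bel_trans K =
     exp_map E (Act E) (fmap (Ff E) (alpha E (Obs K) (obs K))) \<cdot>
     exp_map E (Act E) (fmap (Ff E) (mu E (State K))) \<cdot>
     dlaw' (fobj (Tf E) (State K)) \<cdot>
     fmap (Tf E) (delta K) \<cdot>
     iota E (obs K)"

definition Bel :: "('o, 'm) pcoalg \<Rightarrow> ('o, 'm) pcoalg" where
  "Bel K =
     \<lparr>State = Tbar_obj E (obs K),
      Obs = Obs K,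
      point = eta_bar E (obs K) \<cdot> point K,
      struct = pair E (bel_trans K) (Tbar_arr E (obs K))\<rparr>"

end

end

theory Submission
  imports Defs
begin

text \<open>Let \<open>v\<^sub>n : S \<times> A\<^sup>O\<^sup>* \<rightarrow> \<Omega>\<close> and \<open>w\<^sub>n : B \<times> A\<^sup>O\<^sup>* \<rightarrow> \<Omega>\<close> be the \<open>n\<close>-th iterates from bottom for the original and
  for the belief coalgebra, where \<open>B\<close> is the object of beliefs and \<open>\<iota> : B \<rightarrow> TS\<close>. By induction on \<open>n\<close>,
  \<open>w\<^sub>n = \<sigma> \<cdot> T v\<^sub>n \<cdot> st \<cdot> (\<iota> \<times> id)\<close>. The base case is the strictness assumption on \<open>\<sigma>\<close>. In the
  step, the compatibility of \<open>\<sigma>\<close> and \<open>\<rho>\<close> with \<open>\<lambda>\<close> reduces the claim to an equation between the two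
  scheduled coalgebras that does not mention \<open>\<Omega>\<close>. That equation holds because flattening undoes \<open>\<alpha>\<close>
  and because, by assumption (2), drawing a state from a belief and then observing it gives the
  observation that the belief carries already. On a point \<open>\<eta>\<close> of the belief object, \<open>\<sigma> \<cdot> \<eta> = id\<close>
  turns \<open>w\<^sub>n\<close> back into \<open>v\<^sub>n\<close>.\<close>

notation cross (infixr "\<boxtimes>\<index>" 75)
notation pair ("\<langle>_,/ _\<rangle>\<index>")

section \<open>Typing rules and right-bracketed normal forms for composites\<close>

context category
begin

lemma in_Hom [simp]: "f \<in> Hom C X Y \<longleftrightarrow> f \<in> Arr C \<and> Dom C f = X \<and> Cod C f = Y"
  by (simp add: Hom_def)

lemma Dom_Cod_Obj [simp]: "f \<in> Arr C \<Longrightarrow> Dom C f \<in> Obj C" "f \<in> Arr C \<Longrightarrow> Cod C f \<in> Obj C"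
  by (rule Dom_Obj Cod_Obj, assumption)+

lemma Id_simps [simp]:
  assumes "X \<in> Obj C"
  shows "Id C X \<in> Arr C" "Dom C (Id C X) = X" "Cod C (Id C X) = X"
  using Id_Hom[OF assms] by simp_all

lemma Comp_simps [simp]:
  assumes "f \<in> Arr C" "g \<in> Arr C" "Dom C g = Cod C f"
  shows "g \<cdot> f \<in> Arr C" "Dom C (g \<cdot> f) = Dom C f" "Cod C (g \<cdot> f) = Cod C g"
  using Comp_Hom[of f "Dom C f" "Cod C f" g "Cod C g"] assms by simp_all

lemma Comp_Id [simp]:
  "\<lbrakk>f \<in> Arr C; Y = Cod C f\<rbrakk> \<Longrightarrow> Id C Y \<cdot> f = f"
  "\<lbrakk>f \<in> Arr C; X = Dom C f\<rbrakk> \<Longrightarrow> f \<cdot> Id C X = f"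
  using Id_left Id_right by auto

lemma assoc [simp]:
  "\<lbrakk>f \<in> Arr C; g \<in> Arr C; h \<in> Arr C; Dom C g = Cod C f; Dom C h = Cod C g\<rbrakk>
    \<Longrightarrow> (h \<cdot> g) \<cdot> f = h \<cdot> (g \<cdot> f)"
  using Comp_assoc by simp

text \<open>Since \<open>assoc\<close> brackets every composite to the right, a rule for
  \<open>g \<cdot> f\<close> does not match inside \<open>g \<cdot> (f \<cdot> k)\<close>. The form
  \<open>reassoc[OF ...]\<close> makes such a rule applicable there.\<close>

lemma reassoc:
  assumes "g \<cdot> f = r" "f \<in> Arr C" "g \<in> Arr C" "Dom C g = Cod C f" "k \<in> Arr C" "Cod C k = Dom C f"
  shows "g \<cdot> (f \<cdot> k) = r \<cdot> k"
  using assms by (metis assoc)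

end

section \<open>Cartesian closed structure\<close>

context ccc
begin

lemma One_Obj [simp]: "One C \<in> Obj C"
  using terminal by (simp add: is_terminal_def)

lemma bang_simps [simp]:
  assumes "X \<in> Obj C"
  shows "bang C X \<in> Arr C" "Dom C (bang C X) = X" "Cod C (bang C X) = One C"
proof -
  have "\<exists>!h. h \<in> Hom C X (One C)"
    using terminal assms by (simp add: is_terminal_def)
  from theI'[OF this] show "bang C X \<in> Arr C" "Dom C (bang C X) = X" "Cod C (bang C X) = One C"
    by (simp_all add: bang_def)
qed

lemma Prod_simps [simp]:
  assumes "X \<in> Obj C" "Y \<in> Obj C"
  shows "X \<otimes> Y \<in> Obj C"
    "P1 C X Y \<in> Arr C" "Dom C (P1 C X Y) = X \<otimes> Y" "Cod C (P1 C X Y) = X"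
    "P2 C X Y \<in> Arr C" "Dom C (P2 C X Y) = X \<otimes> Y" "Cod C (P2 C X Y) = Y"
  using products[OF assms] by (simp_all add: is_product_def)

lemma pair_ex1:
  assumes "f \<in> Arr C" "g \<in> Arr C" "Dom C f = Dom C g"
  shows "\<exists>!h. h \<in> Hom C (Dom C f) (Cod C f \<otimes> Cod C g) \<and>
              P1 C (Cod C f) (Cod C g) \<cdot> h = f \<and> P2 C (Cod C f) (Cod C g) \<cdot> h = g"
  using products[of "Cod C f" "Cod C g"] assms by (simp add: is_product_def)

text \<open>In the projection rules the codomains \<open>X\<close> and \<open>Y\<close> are matched
  through premises, so that the rules also fire when they agree with the codomains of
  \<open>f\<close> and \<open>g\<close> only after simplification.\<close>

lemma pair_simps [simp]:
  assumes "f \<in> Arr C" "g \<in> Arr C" "Dom C f = Dom C g"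
  shows "\<langle>f, g\<rangle> \<in> Arr C" "Dom C \<langle>f, g\<rangle> = Dom C g" "Cod C \<langle>f, g\<rangle> = Cod C f \<otimes> Cod C g"
    "\<lbrakk>X = Cod C f; Y = Cod C g\<rbrakk> \<Longrightarrow> P1 C X Y \<cdot> \<langle>f, g\<rangle> = f"
    "\<lbrakk>X = Cod C f; Y = Cod C g\<rbrakk> \<Longrightarrow> P2 C X Y \<cdot> \<langle>f, g\<rangle> = g"
  using theI'[OF pair_ex1[OF assms]] assms(3) by (simp_all add: pair_def)

lemma pair_eqI:
  assumes "h \<in> Arr C" "Cod C h = X \<otimes> Y" "X \<in> Obj C" "Y \<in> Obj C"
    and "P1 C X Y \<cdot> h = f" "P2 C X Y \<cdot> h = g"
  shows "h = \<langle>f, g\<rangle>"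
proof -
  from assms have *: "f \<in> Arr C" "g \<in> Arr C" "Dom C f = Dom C g" "Dom C f = Dom C h"
      "Cod C f = X" "Cod C g = Y"
    by (auto simp: assms(5,6)[symmetric])
  show ?thesis
    by (rule ex1E[OF pair_ex1[OF *(1-3)]]) (metis * assms in_Hom pair_simps)
qed

lemma pair_comp [simp]:
  assumes "f \<in> Arr C" "g \<in> Arr C" "Dom C f = Dom C g" "k \<in> Arr C" "Cod C k = Dom C f"
  shows "\<langle>f, g\<rangle> \<cdot> k = \<langle>f \<cdot> k, g \<cdot> k\<rangle>"
proof (rule pair_eqI[where X = "Cod C f" and Y = "Cod C g"])
  show "P1 C (Cod C f) (Cod C g) \<cdot> (\<langle>f, g\<rangle> \<cdot> k) = f \<cdot> k"
    using assms by (simp flip: assoc)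
  show "P2 C (Cod C f) (Cod C g) \<cdot> (\<langle>f, g\<rangle> \<cdot> k) = g \<cdot> k"
    using assms by (simp flip: assoc)
qed (use assms in simp_all)

lemma pair_proj [simp]:
  "\<lbrakk>X \<in> Obj C; Y \<in> Obj C\<rbrakk> \<Longrightarrow> \<langle>P1 C X Y, P2 C X Y\<rangle> = Id C (X \<otimes> Y)"
  "\<lbrakk>X \<in> Obj C; Y \<in> Obj C; h \<in> Arr C; Cod C h = X \<otimes> Y\<rbrakk>
    \<Longrightarrow> \<langle>P1 C X Y \<cdot> h, P2 C X Y \<cdot> h\<rangle> = h"
  by (rule sym, rule pair_eqI[where X = X and Y = Y]; simp)+

text \<open>Equations between structural maps are decided by unfolding everything to nested pairs of
  composites of projections, which is a normal form.\<close>

lemmas to_pairs = cross_def swap_def assocr_def assocl_def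

lemma cross_simps [simp]:
  assumes "f \<in> Arr C" "g \<in> Arr C"
  shows "f \<boxtimes> g \<in> Arr C" "Dom C (f \<boxtimes> g) = Dom C f \<otimes> Dom C g"
    "Cod C (f \<boxtimes> g) = Cod C f \<otimes> Cod C g"
  using assms by (simp_all add: cross_def)

lemma swap_simps [simp]:
  assumes "X \<in> Obj C" "Y \<in> Obj C"
  shows "swap C X Y \<in> Arr C" "Dom C (swap C X Y) = X \<otimes> Y" "Cod C (swap C X Y) = Y \<otimes> X"
    "swap C Y X \<cdot> swap C X Y = Id C (X \<otimes> Y)"
    "\<lbrakk>k \<in> Arr C; Cod C k = X \<otimes> Y\<rbrakk> \<Longrightarrow> swap C Y X \<cdot> (swap C X Y \<cdot> k) = k"
  using assms by (simp_all add: swap_def)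

lemma assocr_simps [simp]:
  assumes "X \<in> Obj C" "Y \<in> Obj C" "Z \<in> Obj C"
  shows "assocr C X Y Z \<in> Arr C" "Dom C (assocr C X Y Z) = (X \<otimes> Y) \<otimes> Z"
    "Cod C (assocr C X Y Z) = X \<otimes> (Y \<otimes> Z)"
  using assms by (simp_all add: assocr_def)

lemma assocl_simps [simp]:
  assumes "X \<in> Obj C" "Y \<in> Obj C" "Z \<in> Obj C"
  shows "assocl C X Y Z \<in> Arr C" "Dom C (assocl C X Y Z) = X \<otimes> (Y \<otimes> Z)"
    "Cod C (assocl C X Y Z) = (X \<otimes> Y) \<otimes> Z"
  using assms by (simp_all add: assocl_def)

lemma assoc_inverse:
  assumes "X \<in> Obj C" "Y \<in> Obj C" "Z \<in> Obj C"
  shows "assocr C X Y Z \<cdot> assocl C X Y Z = Id C (X \<otimes> (Y \<otimes> Z))"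
    "assocl C X Y Z \<cdot> assocr C X Y Z = Id C ((X \<otimes> Y) \<otimes> Z)"
  using assms by (simp_all add: to_pairs)

lemma cross_comp:
  assumes "f \<in> Arr C" "g \<in> Arr C" "f' \<in> Arr C" "g' \<in> Arr C" "Dom C f' = Cod C f" "Dom C g' = Cod C g"
  shows "(f' \<boxtimes> g') \<cdot> (f \<boxtimes> g) = (f' \<cdot> f) \<boxtimes> (g' \<cdot> g)"
  using assms by (simp add: to_pairs)

lemma cross_pair:
  assumes "f \<in> Arr C" "g \<in> Arr C" "f' \<in> Arr C" "g' \<in> Arr C" "Dom C f' = Cod C f" "Dom C g' = Cod C g"
    "Dom C f = Dom C g"
  shows "(f' \<boxtimes> g') \<cdot> \<langle>f, g\<rangle> = \<langle>f' \<cdot> f, g' \<cdot> g\<rangle>"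
  using assms by (simp add: to_pairs)

lemma swap_cross:
  assumes "f \<in> Hom C X X'" "g \<in> Hom C Y Y'"
  shows "swap C X' Y' \<cdot> (f \<boxtimes> g) = (g \<boxtimes> f) \<cdot> swap C X Y"
  using assms by (auto simp add: to_pairs)

section \<open>Exponentials and transposition\<close>

lemma Exp_simps [simp]:
  assumes "Z \<in> Obj C" "Y \<in> Obj C"
  shows "Exp C Z Y \<in> Obj C" "Ev C Z Y \<in> Arr C" "Dom C (Ev C Z Y) = Exp C Z Y \<otimes> Y"
    "Cod C (Ev C Z Y) = Z"
  using exponentials[OF assms] by (simp_all add: is_exponential_def)

lemma curry_ex1:
  assumes "X \<in> Obj C" "Y \<in> Obj C" "f \<in> Arr C" "Dom C f = X \<otimes> Y"
  shows "\<exists>!h. h \<in> Hom C X (Exp C (Cod C f) Y) \<and> Ev C (Cod C f) Y \<cdot> (h \<boxtimes> Id C Y) = f"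
  using exponentials[of "Cod C f" Y] assms by (simp add: is_exponential_def)

lemma curry_simps [simp]:
  assumes "X \<in> Obj C" "Y \<in> Obj C" "f \<in> Arr C" "Dom C f = X \<otimes> Y"
  shows "curry C X Y f \<in> Arr C" "Dom C (curry C X Y f) = X"
    "Cod C (curry C X Y f) = Exp C (Cod C f) Y"
    "Z = Cod C f \<Longrightarrow> uncurry C Y Z (curry C X Y f) = f"
  using theI'[OF curry_ex1[OF assms]] by (simp_all add: curry_def uncurry_def)

lemma uncurry_simps [simp]:
  assumes "g \<in> Arr C" "Cod C g = Exp C Z Y" "Z \<in> Obj C" "Y \<in> Obj C"
  shows "uncurry C Y Z g \<in> Arr C" "Dom C (uncurry C Y Z g) = Dom C g \<otimes> Y"
    "Cod C (uncurry C Y Z g) = Z"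
  using assms by (simp_all add: uncurry_def)

text \<open>This is the uniqueness half of the universal property of the exponential. It allows
  equations between arrows into an exponential to be checked after transposition.\<close>

lemma uncurry_inject:
  assumes "g \<in> Hom C X (Exp C Z Y)" "h \<in> Hom C X (Exp C Z Y)" "Z \<in> Obj C" "Y \<in> Obj C"
    and "uncurry C Y Z g = uncurry C Y Z h"
  shows "g = h"
proof -
  have "X \<in> Obj C"
    using assms(1) by auto
  then have "\<exists>!k. k \<in> Hom C X (Exp C Z Y) \<and> Ev C Z Y \<cdot> (k \<boxtimes> Id C Y) = uncurry C Y Z g"
    using curry_ex1[of X Y "uncurry C Y Z g"] assms(1-4) by simp
  then show ?thesis
    using assms by (auto simp: uncurry_def)
qed

lemma uncurry_comp:
  assumes "g \<in> Arr C" "h \<in> Arr C" "Dom C g = Cod C h" "Cod C g = Exp C Z Y" "Z \<in> Obj C" "Y \<in> Obj C"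
  shows "uncurry C Y Z (g \<cdot> h) = uncurry C Y Z g \<cdot> (h \<boxtimes> Id C Y)"
  using assms by (simp add: uncurry_def cross_comp)

lemma exp_map_simps [simp]:
  assumes "f \<in> Arr C" "A \<in> Obj C"
  shows "exp_map C A f \<in> Arr C" "Dom C (exp_map C A f) = Exp C (Dom C f) A"
    "Cod C (exp_map C A f) = Exp C (Cod C f) A"
  using assms by (simp_all add: exp_map_def)

lemma uncurry_exp_map:
  assumes "f \<in> Arr C" "A \<in> Obj C" "g \<in> Arr C" "Cod C g = Exp C (Dom C f) A" "Z = Cod C f"
  shows "uncurry C A Z (exp_map C A f \<cdot> g) = f \<cdot> uncurry C A (Dom C f) g"
proof -
  have "uncurry C A Z (exp_map C A f) = f \<cdot> Ev C (Dom C f) A"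
    using assms by (simp add: exp_map_def)
  then show ?thesis
    using assms by (simp add: uncurry_comp) (simp add: uncurry_def)
qed

section \<open>Words as countable coproducts, and the maps built on them\<close>

lemma pow_obj_Obj [simp]: "X \<in> Obj C \<Longrightarrow> pow_obj C X n \<in> Obj C"
  by (induction n) simp_all

lemma coprod_ex1:
  assumes "\<And>j. j \<in> J \<Longrightarrow> D j \<in> Obj C" "W \<in> Obj C" "\<And>j. j \<in> J \<Longrightarrow> f j \<in> Hom C (D j) W"
  shows "\<exists>!h. h \<in> Hom C (Coprod C J D) W \<and> (\<forall>j\<in>J. h \<cdot> Inj C J D j = f j)"
  using countable_coproducts[of J D] assms unfolding is_coproduct_def by blast

lemma coprod_simps:
  assumes "\<And>j. j \<in> J \<Longrightarrow> D j \<in> Obj C"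
  shows "Coprod C J D \<in> Obj C" "j \<in> J \<Longrightarrow> Inj C J D j \<in> Hom C (D j) (Coprod C J D)"
  using countable_coproducts[of J D] assms unfolding is_coproduct_def by blast+

lemma star_plus_simps [simp]:
  assumes "X \<in> Obj C"
  shows "star_obj C X \<in> Obj C" "plus_obj C X \<in> Obj C"
    "Inj C UNIV (pow_obj C X) n \<in> Arr C"
    "Dom C (Inj C UNIV (pow_obj C X) n) = pow_obj C X n"
    "Cod C (Inj C UNIV (pow_obj C X) n) = star_obj C X"
    "m \<ge> Suc 0 \<Longrightarrow> Inj C {Suc 0..} (pow_obj C X) m \<in> Arr C"
    "m \<ge> Suc 0 \<Longrightarrow> Dom C (Inj C {Suc 0..} (pow_obj C X) m) = pow_obj C X m"
    "m \<ge> Suc 0 \<Longrightarrow> Cod C (Inj C {Suc 0..} (pow_obj C X) m) = plus_obj C X"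
  using coprod_simps[where D = "pow_obj C X"] assms by (simp_all add: star_obj_def plus_obj_def)

text \<open>The functor \<open>X \<otimes> -\<close> is a left adjoint and so preserves coproducts;
  the proof carries this out by hand. A candidate \<open>k\<close> is transposed to an arrow from
  \<open>star_obj C X\<close> into an exponential, and that arrow is determined by its components at
  each word length. This justifies the definite description in \<open>cons\<close>.\<close>

lemma cons_ex1:
  assumes X: "X \<in> Obj C"
  shows "\<exists>!k. k \<in> Hom C (X \<otimes> star_obj C X) (plus_obj C X) \<and>
              (\<forall>n. k \<cdot> (Id C X \<boxtimes> Inj C UNIV (pow_obj C X) n) = Inj C {1..} (pow_obj C X) (Suc n))"
    (is "\<exists>!k. ?P k")
proof -
  let ?S = "star_obj C X" and ?Q = "plus_obj C X"
  let ?i = "Inj C UNIV (pow_obj C X)" and ?j = "Inj C {1..} (pow_obj C X)"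
  \<comment> \<open>The index rises by one because \<open>X \<otimes> pow_obj C X n\<close> is
    \<open>pow_obj C X (Suc n)\<close> by definition. The swap is there because \<open>curry\<close>
    abstracts the second factor, while \<open>X\<close> stands first.\<close>
  let ?f = "\<lambda>n. curry C (pow_obj C X n) X (?j (Suc n) \<cdot> swap C (pow_obj C X n) X)"
  let ?R = "\<lambda>h. h \<in> Hom C ?S (Exp C ?Q X) \<and> (\<forall>n. h \<cdot> ?i n = ?f n)"
  have ex1: "\<exists>!h. ?R h"
    using coprod_ex1[of UNIV "pow_obj C X" "Exp C ?Q X" ?f] X by (simp flip: star_obj_def)
  have curried: "?R (curry C ?S X (k \<cdot> swap C ?S X))" if k: "?P k" for k
  proof (intro conjI allI)
    let ?k = "curry C ?S X (k \<cdot> swap C ?S X)"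
    show "?k \<in> Hom C ?S (Exp C ?Q X)"
      using k X by simp
    fix n
    have "uncurry C X ?Q (?k \<cdot> ?i n) = k \<cdot> (swap C ?S X \<cdot> (?i n \<boxtimes> Id C X))"
      using k X by (simp add: uncurry_comp)
    also have "\<dots> = k \<cdot> ((Id C X \<boxtimes> ?i n) \<cdot> swap C (pow_obj C X n) X)"
      using X by (subst swap_cross[of _ "pow_obj C X n" _ _ X]) simp_all
    also have "\<dots> = ?j (Suc n) \<cdot> swap C (pow_obj C X n) X"
      by (rule reassoc) (use k X in simp_all)
    also have "\<dots> = uncurry C X ?Q (?f n)"
      using k X by simp
    finally show "?k \<cdot> ?i n = ?f n"
      by (rule uncurry_inject[rotated 4, where X = "pow_obj C X n"]) (use k X in simp_all)
  qed
  have uncurried: "?P (uncurry C X ?Q h \<cdot> swap C X ?S)" if h: "?R h" for h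
  proof (intro conjI allI)
    show "uncurry C X ?Q h \<cdot> swap C X ?S \<in> Hom C (X \<otimes> ?S) ?Q"
      using h X by simp
    fix n
    have "(uncurry C X ?Q h \<cdot> swap C X ?S) \<cdot> (Id C X \<boxtimes> ?i n)
        = uncurry C X ?Q h \<cdot> (swap C X ?S \<cdot> (Id C X \<boxtimes> ?i n))"
      using h X by simp
    also have "\<dots> = uncurry C X ?Q h \<cdot> ((?i n \<boxtimes> Id C X) \<cdot> swap C X (pow_obj C X n))"
      using X by (subst swap_cross[of _ X _ _ "pow_obj C X n"]) simp_all
    also have "\<dots> = uncurry C X ?Q (h \<cdot> ?i n) \<cdot> swap C X (pow_obj C X n)"
      using h X by (intro reassoc[OF uncurry_comp[symmetric]]) simp_all
    also have "\<dots> = ?j (Suc n)"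
      using h X by simp
    finally show "(uncurry C X ?Q h \<cdot> swap C X ?S) \<cdot> (Id C X \<boxtimes> ?i n) = ?j (Suc n)" .
  qed
  from ex1 obtain h where h: "?R h" by blast
  show ?thesis
  proof (rule ex1I[of ?P], rule uncurried[OF h])
    \<comment> \<open>Every candidate transposes to the one solution \<open>h\<close>, so
      transposing back always gives the same arrow.\<close>
    fix k assume k: "?P k"
    have "curry C ?S X (k \<cdot> swap C ?S X) = h"
      using ex1 h curried[OF k] by blast
    then have "uncurry C X ?Q h = k \<cdot> swap C ?S X"
      using k X by (metis curry_simps(4) in_Hom Comp_simps Prod_simps(1) star_plus_simps(1) swap_simps)
    then show "k = uncurry C X ?Q h \<cdot> swap C X ?S"
      using k X by simp
  qed
qed

lemma cons_simps [simp]: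
  assumes "X \<in> Obj C"
  shows "cons C X \<in> Arr C" "Dom C (cons C X) = X \<otimes> star_obj C X" "Cod C (cons C X) = plus_obj C X"
  using theI'[OF cons_ex1[OF assms]] by (simp_all add: cons_def)

lemma plus_incl_simps [simp]:
  assumes "X \<in> Obj C"
  shows "plus_incl C X \<in> Arr C" "Dom C (plus_incl C X) = plus_obj C X"
    "Cod C (plus_incl C X) = star_obj C X"
proof -
  have "\<exists>!j. j \<in> Hom C (plus_obj C X) (star_obj C X) \<and>
             (\<forall>n\<ge>1. j \<cdot> Inj C {1..} (pow_obj C X) n = Inj C UNIV (pow_obj C X) n)"
    using coprod_ex1[of "{1..}" "pow_obj C X" "star_obj C X" "Inj C UNIV (pow_obj C X)"] assms
    by (simp add: plus_obj_def Ball_def)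
  from theI'[OF this] show "plus_incl C X \<in> Arr C" "Dom C (plus_incl C X) = plus_obj C X"
    "Cod C (plus_incl C X) = star_obj C X"
    by (simp_all add: plus_incl_def)
qed

lemma split_exp_simps [simp]:
  assumes "A \<in> Obj C" "X \<in> Obj C"
  shows "split_exp C A X \<in> Arr C" "Dom C (split_exp C A X) = Exp C A (star_obj C X)"
    "Cod C (split_exp C A X) = A \<otimes> Exp C A (plus_obj C X)"
  using assms by (simp_all add: split_exp_def Let_def nil_def)

lemma ev_cons_simps [simp]:
  assumes "A \<in> Obj C" "X \<in> Obj C"
  shows "ev_cons C A X \<in> Arr C" "Dom C (ev_cons C A X) = X \<otimes> Exp C A (plus_obj C X)"
    "Cod C (ev_cons C A X) = Exp C A (star_obj C X)"
  using assms by (simp_all add: ev_cons_def Let_def)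

lemma into_pb_simps:
  assumes "f \<in> Arr C" "g \<in> Arr C" "Cod C f = Cod C g"
    and "a \<in> Arr C" "b \<in> Arr C" "Cod C a = Dom C f" "Cod C b = Dom C g" "Dom C a = Dom C b"
    and "f \<cdot> a = g \<cdot> b"
  shows "into_pb C f g a b \<in> Hom C (Dom C a) (Pb C f g)"
    "Pb1 C f g \<cdot> into_pb C f g a b = a" "Pb2 C f g \<cdot> into_pb C f g a b = b"
proof -
  have "\<exists>!h. h \<in> Hom C (Dom C a) (Pb C f g) \<and> Pb1 C f g \<cdot> h = a \<and> Pb2 C f g \<cdot> h = b"
    using pullbacks[of f g] assms by (simp add: is_pullback_def)
  from theI'[OF this] show "into_pb C f g a b \<in> Hom C (Dom C a) (Pb C f g)"
    "Pb1 C f g \<cdot> into_pb C f g a b = a" "Pb2 C f g \<cdot> into_pb C f g a b = b"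
    by (simp_all add: into_pb_def)
qed

end

section \<open>Strengths\<close>

text \<open>Kept general because it is instantiated twice, at \<open>T\<close> and at
  \<open>F\<close>. The composite \<open>FT\<close> is reduced to these two instances by
  \<open>rst_FT\<close>.\<close>

locale strong_functor = ccc C for C :: "('o, 'm, 'x) ccc_scheme" (structure) +
  fixes G :: "('o, 'm) endo" and st :: "'o \<Rightarrow> 'o \<Rightarrow> 'm"
  assumes strong: "strong_endofunctor C G st"
begin

lemma fobj_Obj [simp]: "X \<in> Obj C \<Longrightarrow> fobj G X \<in> Obj C"
  using strong by (simp add: strong_endofunctor_def is_functor_def)

lemma fmap_simps [simp]:
  assumes "f \<in> Arr C"
  shows "fmap G f \<in> Arr C" "Dom C (fmap G f) = fobj G (Dom C f)"
    "Cod C (fmap G f) = fobj G (Cod C f)"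
  using strong assms by (simp_all add: strong_endofunctor_def is_functor_def)

lemma fmap_Id [simp]: "X \<in> Obj C \<Longrightarrow> fmap G (Id C X) = Id C (fobj G X)"
  using strong by (simp add: strong_endofunctor_def is_functor_def)

lemma fmap_comp:
  "\<lbrakk>f \<in> Arr C; g \<in> Arr C; Dom C g = Cod C f\<rbrakk> \<Longrightarrow> fmap G (g \<cdot> f) = fmap G g \<cdot> fmap G f"
  using strong by (simp add: strong_endofunctor_def is_functor_def)

lemma strength_simps [simp]:
  assumes "X \<in> Obj C" "Y \<in> Obj C"
  shows "st X Y \<in> Arr C" "Dom C (st X Y) = X \<otimes> fobj G Y" "Cod C (st X Y) = fobj G (X \<otimes> Y)"
  using strong assms by (simp_all add: strong_endofunctor_def is_strength_def)

lemma strength_natural: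
  assumes "f \<in> Hom C X X'" "g \<in> Hom C Y Y'"
  shows "st X' Y' \<cdot> (f \<boxtimes> fmap G g) = fmap G (f \<boxtimes> g) \<cdot> st X Y"
  using strong assms unfolding strong_endofunctor_def is_strength_def by metis

lemma strength_assoc:
  assumes "X \<in> Obj C" "Y \<in> Obj C" "Z \<in> Obj C"
  shows "st X (Y \<otimes> Z) \<cdot> ((Id C X \<boxtimes> st Y Z) \<cdot> assocr C X Y (fobj G Z))
    = fmap G (assocr C X Y Z) \<cdot> st (X \<otimes> Y) Z"
  using strong assms by (simp add: strong_endofunctor_def is_strength_def)

abbreviation rst where
  "rst X Y \<equiv> rstrength C G st X Y"

lemma rst_simps [simp]:
  assumes "X \<in> Obj C" "Y \<in> Obj C"
  shows "rst X Y \<in> Arr C" "Dom C (rst X Y) = fobj G X \<otimes> Y" "Cod C (rst X Y) = fobj G (X \<otimes> Y)"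
  using assms by (simp_all add: rstrength_def)

text \<open>Naturality of the left strength is conjugated by the symmetry, which is itself
  natural.\<close>

lemma rst_natural:
  assumes fg: "f \<in> Hom C X X'" "g \<in> Hom C Y Y'"
  shows "rst X' Y' \<cdot> (fmap G f \<boxtimes> g) = fmap G (f \<boxtimes> g) \<cdot> rst X Y"
proof -
  have XY: "X \<in> Obj C" "Y \<in> Obj C" "X' \<in> Obj C" "Y' \<in> Obj C"
    using fg by auto
  have "rst X' Y' \<cdot> (fmap G f \<boxtimes> g)
      = fmap G (swap C Y' X') \<cdot> (st Y' X' \<cdot> (swap C (fobj G X') Y' \<cdot> (fmap G f \<boxtimes> g)))"
    using fg XY by (simp add: rstrength_def)
  also have "\<dots> = fmap G (swap C Y' X') \<cdot> (st Y' X' \<cdot> ((g \<boxtimes> fmap G f) \<cdot> swap C (fobj G X) Y))"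
    using fg by (subst swap_cross[of _ "fobj G X" _ _ Y]) simp_all
  also have "\<dots> = fmap G (swap C Y' X') \<cdot> (fmap G (g \<boxtimes> f) \<cdot> (st Y X \<cdot> swap C (fobj G X) Y))"
    using fg XY by (subst reassoc[OF strength_natural[OF fg(2,1)]]) simp_all
  also have "\<dots> = fmap G (swap C Y' X' \<cdot> (g \<boxtimes> f)) \<cdot> (st Y X \<cdot> swap C (fobj G X) Y)"
    using fg XY by (simp add: fmap_comp)
  also have "\<dots> = fmap G (f \<boxtimes> g) \<cdot> rst X Y"
    using fg XY by (simp add: swap_cross[OF fg(2,1)] fmap_comp rstrength_def)
  finally show ?thesis .
qed

text \<open>The associativity law of the left strength is used at the reversed triple
  \<open>Z\<close>, \<open>Y\<close>, \<open>X\<close>. Conjugation with symmetries then yields the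
  parameter \<open>Z \<otimes> Y\<close> in place of \<open>Y \<otimes> Z\<close>, and naturality of
  the strength in its parameter repairs the order.\<close>

lemma rst_assoc:
  assumes XYZ [simp]: "X \<in> Obj C" "Y \<in> Obj C" "Z \<in> Obj C"
  shows "rst X (Y \<otimes> Z) \<cdot> assocr C (fobj G X) Y Z
    = fmap G (assocr C X Y Z) \<cdot> (rst (X \<otimes> Y) Z \<cdot> (rst X Y \<boxtimes> Id C Z))"
proof -
  \<comment> \<open>What stands to the right of the structural maps under \<open>G\<close> once
    \<open>strength_assoc\<close> has merged the two strengths into one with parameter
    \<open>Z \<otimes> Y\<close>.\<close>
  let ?m = "st (Z \<otimes> Y) X \<cdot> (assocl C Z Y (fobj G X) \<cdot> ((Id C Z \<boxtimes> swap C (fobj G X) Y) \<cdot>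
              swap C (fobj G X \<otimes> Y) Z))"
  let ?GX = "fobj G X"
  have "fmap G (assocr C X Y Z) \<cdot> (rst (X \<otimes> Y) Z \<cdot> (rst X Y \<boxtimes> Id C Z))
      = fmap G (assocr C X Y Z) \<cdot> (fmap G (swap C Z (X \<otimes> Y)) \<cdot> (st Z (X \<otimes> Y) \<cdot>
          (swap C (fobj G (X \<otimes> Y)) Z \<cdot> (rst X Y \<boxtimes> Id C Z))))"
    by (simp add: rstrength_def)
  also have "swap C (fobj G (X \<otimes> Y)) Z \<cdot> (rst X Y \<boxtimes> Id C Z)
      = (Id C Z \<boxtimes> rst X Y) \<cdot> swap C (?GX \<otimes> Y) Z"
    by (rule swap_cross) simp_all
  also have "Id C Z \<boxtimes> rst X Y
      = (Id C Z \<boxtimes> fmap G (swap C Y X)) \<cdot> ((Id C Z \<boxtimes> st Y X) \<cdot> (Id C Z \<boxtimes> swap C ?GX Y))"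
    by (simp add: cross_comp rstrength_def)
  also have "fmap G (assocr C X Y Z) \<cdot> (fmap G (swap C Z (X \<otimes> Y)) \<cdot> (st Z (X \<otimes> Y) \<cdot>
        (((Id C Z \<boxtimes> fmap G (swap C Y X)) \<cdot> ((Id C Z \<boxtimes> st Y X) \<cdot> (Id C Z \<boxtimes> swap C ?GX Y)))
          \<cdot> swap C (?GX \<otimes> Y) Z)))
      = fmap G (assocr C X Y Z) \<cdot> (fmap G (swap C Z (X \<otimes> Y)) \<cdot> (fmap G (Id C Z \<boxtimes> swap C Y X) \<cdot>
        (st Z (Y \<otimes> X) \<cdot> ((Id C Z \<boxtimes> st Y X) \<cdot> ((Id C Z \<boxtimes> swap C ?GX Y)
          \<cdot> swap C (?GX \<otimes> Y) Z)))))"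
    by (simp add: reassoc[OF strength_natural[where X = Z and Y = "Y \<otimes> X"]])
  \<comment> \<open>A pair of inverse associators is inserted, since \<open>strength_assoc\<close>
    needs an \<open>assocr\<close> next to the two strengths.\<close>
  also have "(Id C Z \<boxtimes> swap C ?GX Y) \<cdot> swap C (?GX \<otimes> Y) Z
      = assocr C Z Y ?GX \<cdot> (assocl C Z Y ?GX \<cdot> ((Id C Z \<boxtimes> swap C ?GX Y) \<cdot> swap C (?GX \<otimes> Y) Z))"
    by (simp add: reassoc[OF assoc_inverse(1)])
  also have "fmap G (assocr C X Y Z) \<cdot> (fmap G (swap C Z (X \<otimes> Y)) \<cdot> (fmap G (Id C Z \<boxtimes> swap C Y X) \<cdot>
        (st Z (Y \<otimes> X) \<cdot> ((Id C Z \<boxtimes> st Y X) \<cdot> (assocr C Z Y ?GX \<cdot> (assocl C Z Y ?GX \<cdot>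
          ((Id C Z \<boxtimes> swap C ?GX Y) \<cdot> swap C (?GX \<otimes> Y) Z)))))))
      = fmap G (assocr C X Y Z) \<cdot> (fmap G (swap C Z (X \<otimes> Y)) \<cdot> (fmap G (Id C Z \<boxtimes> swap C Y X) \<cdot>
          (fmap G (assocr C Z Y X) \<cdot> ?m)))"
    using reassoc[OF strength_assoc[of Z Y X],
        where k = "assocl C Z Y ?GX \<cdot> ((Id C Z \<boxtimes> swap C ?GX Y) \<cdot> swap C (?GX \<otimes> Y) Z)"]
    by simp
  also have "\<dots> = fmap G (assocr C X Y Z \<cdot> (swap C Z (X \<otimes> Y) \<cdot> ((Id C Z \<boxtimes> swap C Y X) \<cdot>
          assocr C Z Y X))) \<cdot> ?m"
    by (simp add: fmap_comp)
  also have "assocr C X Y Z \<cdot> (swap C Z (X \<otimes> Y) \<cdot> ((Id C Z \<boxtimes> swap C Y X) \<cdot> assocr C Z Y X))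
      = swap C (Y \<otimes> Z) X \<cdot> (swap C Z Y \<boxtimes> Id C X)"
    by (simp add: to_pairs)
  also have "assocl C Z Y ?GX \<cdot> ((Id C Z \<boxtimes> swap C ?GX Y) \<cdot> swap C (?GX \<otimes> Y) Z)
      = (swap C Y Z \<boxtimes> Id C ?GX) \<cdot> (swap C ?GX (Y \<otimes> Z) \<cdot> assocr C ?GX Y Z)"
    by (simp add: to_pairs)
  also have "fmap G (swap C (Y \<otimes> Z) X \<cdot> (swap C Z Y \<boxtimes> Id C X)) \<cdot> (st (Z \<otimes> Y) X \<cdot>
        ((swap C Y Z \<boxtimes> Id C ?GX) \<cdot> (swap C ?GX (Y \<otimes> Z) \<cdot> assocr C ?GX Y Z)))
      = fmap G (swap C (Y \<otimes> Z) X) \<cdot> (fmap G (swap C Z Y \<boxtimes> Id C X) \<cdot> (st (Z \<otimes> Y) X \<cdot>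
        ((swap C Y Z \<boxtimes> Id C ?GX) \<cdot> (swap C ?GX (Y \<otimes> Z) \<cdot> assocr C ?GX Y Z))))"
    by (simp add: fmap_comp)
  \<comment> \<open>Naturality moves the symmetry on the parameter through the strength, where it
    meets its inverse.\<close>
  also have "\<dots> = fmap G (swap C (Y \<otimes> Z) X) \<cdot> (st (Y \<otimes> Z) X \<cdot> ((swap C Z Y \<boxtimes> Id C ?GX) \<cdot>
        ((swap C Y Z \<boxtimes> Id C ?GX) \<cdot> (swap C ?GX (Y \<otimes> Z) \<cdot> assocr C ?GX Y Z))))"
    using reassoc[OF strength_natural[of "swap C Z Y" "Z \<otimes> Y" "Y \<otimes> Z" "Id C X" X X],
        where k = "(swap C Y Z \<boxtimes> Id C ?GX) \<cdot> (swap C ?GX (Y \<otimes> Z) \<cdot> assocr C ?GX Y Z)"]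
    by simp
  also have "\<dots> = rst X (Y \<otimes> Z) \<cdot> assocr C ?GX Y Z"
    by (simp add: rstrength_def) (simp add: to_pairs)
  finally show ?thesis by simp
qed

text \<open>Obtained by inverting the associators in \<open>rst_assoc\<close>. This is the direction
  in which \<open>split_state\<close> regroups state, action and tail.\<close>

lemma rst_assocl:
  assumes XYZ [simp]: "X \<in> Obj C" "Y \<in> Obj C" "Z \<in> Obj C"
  shows "fmap G (assocl C X Y Z) \<cdot> rst X (Y \<otimes> Z)
    = rst (X \<otimes> Y) Z \<cdot> ((rst X Y \<boxtimes> Id C Z) \<cdot> assocl C (fobj G X) Y Z)"
proof -
  let ?GX = "fobj G X"
  have "fmap G (assocl C X Y Z) \<cdot> rst X (Y \<otimes> Z)
      = fmap G (assocl C X Y Z) \<cdot> (rst X (Y \<otimes> Z) \<cdot> (assocr C ?GX Y Z \<cdot> assocl C ?GX Y Z))"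
    by (simp add: assoc_inverse)
  also have "\<dots> = fmap G (assocl C X Y Z) \<cdot> (fmap G (assocr C X Y Z) \<cdot> (rst (X \<otimes> Y) Z \<cdot>
      ((rst X Y \<boxtimes> Id C Z) \<cdot> assocl C ?GX Y Z)))"
    by (simp add: reassoc[OF rst_assoc])
  also have "\<dots> = fmap G (assocl C X Y Z \<cdot> assocr C X Y Z) \<cdot> (rst (X \<otimes> Y) Z \<cdot>
      ((rst X Y \<boxtimes> Id C Z) \<cdot> assocl C ?GX Y Z))"
    by (subst fmap_comp) simp_all
  also have "\<dots> = rst (X \<otimes> Y) Z \<cdot> ((rst X Y \<boxtimes> Id C Z) \<cdot> assocl C ?GX Y Z)"
    by (simp add: assoc_inverse)
  finally show ?thesis .
qed

end

section \<open>Monad, distributive law and beliefs\<close>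

sublocale setting \<subseteq> T: strong_functor E "Tf E" "stT E"
  using monad by unfold_locales (simp add: strong_monad_def is_monad_def strong_endofunctor_def)

sublocale setting \<subseteq> F: strong_functor E "Ff E" "stF E"
  using functor_F by unfold_locales

context setting
begin

lemma Act_Obj [simp]: "Act E \<in> Obj E"
  by (rule Act)

lemma FT_simps [simp]:
  "fobj (FT E) X = fobj (Ff E) (fobj (Tf E) X)"
  "fmap (FT E) f = fmap (Ff E) (fmap (Tf E) f)"
  by (simp_all add: FT_def fcomp_def)

lemma eta_simps [simp]:
  assumes "X \<in> Obj E"
  shows "eta E X \<in> Arr E" "Dom E (eta E X) = X" "Cod E (eta E X) = fobj (Tf E) X"
  using monad assms by (simp_all add: strong_monad_def is_monad_def natural_def id_functor_def)

lemma eta_natural: "f \<in> Hom E X Y \<Longrightarrow> fmap (Tf E) f \<cdot> eta E X = eta E Y \<cdot> f"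
  using monad by (simp add: strong_monad_def is_monad_def natural_def id_functor_def)

lemma mu_simps [simp]:
  assumes "X \<in> Obj E"
  shows "mu E X \<in> Arr E" "Dom E (mu E X) = fobj (Tf E) (fobj (Tf E) X)"
    "Cod E (mu E X) = fobj (Tf E) X"
  using monad assms by (simp_all add: strong_monad_def is_monad_def natural_def fcomp_def)

lemma mu_natural:
  "f \<in> Hom E X Y \<Longrightarrow> mu E Y \<cdot> fmap (Tf E) (fmap (Tf E) f) = fmap (Tf E) f \<cdot> mu E X"
  using monad by (simp add: strong_monad_def is_monad_def natural_def fcomp_def)

lemma dlaw_simps [simp]:
  assumes "X \<in> Obj E"
  shows "dlaw E X \<in> Arr E" "Dom E (dlaw E X) = fobj (Tf E) (fobj (Ff E) X)"
    "Cod E (dlaw E X) = fobj (Ff E) (fobj (Tf E) X)"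
  using dlaw assms by (simp_all add: distributive_law_def natural_def fcomp_def)

lemma dlaw_natural:
  "f \<in> Hom E X Y \<Longrightarrow>
    dlaw E Y \<cdot> fmap (Tf E) (fmap (Ff E) f) = fmap (Ff E) (fmap (Tf E) f) \<cdot> dlaw E X"
  using dlaw by (simp add: distributive_law_def natural_def fcomp_def)

lemma rst_eta:
  assumes XY [simp]: "X \<in> Obj E" "Y \<in> Obj E"
  shows "T.rst X Y \<cdot> (eta E X \<boxtimes> Id E Y) = eta E (X \<otimes> Y)"
proof -
  have st: "stT E Y X \<cdot> (Id E Y \<boxtimes> eta E X) = eta E (Y \<otimes> X)"
    using monad by (simp add: strong_monad_def)
  have "T.rst X Y \<cdot> (eta E X \<boxtimes> Id E Y)
      = fmap (Tf E) (swap E Y X) \<cdot> (stT E Y X \<cdot> ((Id E Y \<boxtimes> eta E X) \<cdot> swap E X Y))"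
    by (simp add: rstrength_def swap_cross[of "eta E X" X _ "Id E Y" Y])
  also have "\<dots> = fmap (Tf E) (swap E Y X) \<cdot> (eta E (Y \<otimes> X) \<cdot> swap E X Y)"
    by (simp add: reassoc[OF st])
  also have "\<dots> = eta E (X \<otimes> Y)"
    by (simp add: reassoc[OF eta_natural[of _ "Y \<otimes> X" "X \<otimes> Y"]])
  finally show ?thesis .
qed

text \<open>The multiplication law of the left strength is carried across the symmetry, which passes
  through \<open>mu\<close> by naturality.\<close>

lemma rst_mu:
  assumes XY [simp]: "X \<in> Obj E" "Y \<in> Obj E"
  shows "mu E (X \<otimes> Y) \<cdot> (fmap (Tf E) (T.rst X Y) \<cdot> T.rst (fobj (Tf E) X) Y)
    = T.rst X Y \<cdot> (mu E X \<boxtimes> Id E Y)"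
proof -
  let ?T = "fobj (Tf E)" and ?f = "fmap (Tf E)"
  have st: "stT E Y X \<cdot> (Id E Y \<boxtimes> mu E X) = mu E (Y \<otimes> X) \<cdot> (?f (stT E Y X) \<cdot> stT E Y (?T X))"
    using monad by (simp add: strong_monad_def)
  have "T.rst X Y \<cdot> (mu E X \<boxtimes> Id E Y)
      = ?f (swap E Y X) \<cdot> (stT E Y X \<cdot> ((Id E Y \<boxtimes> mu E X) \<cdot> swap E (?T (?T X)) Y))"
    by (simp add: rstrength_def swap_cross[of "mu E X" "?T (?T X)" _ "Id E Y" Y])
  also have "\<dots> = ?f (swap E Y X) \<cdot> (mu E (Y \<otimes> X) \<cdot>
      (?f (stT E Y X) \<cdot> (stT E Y (?T X) \<cdot> swap E (?T (?T X)) Y)))"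
    by (simp add: reassoc[OF st])
  also have "\<dots> = mu E (X \<otimes> Y) \<cdot> (?f (?f (swap E Y X)) \<cdot>
      (?f (stT E Y X) \<cdot> (stT E Y (?T X) \<cdot> swap E (?T (?T X)) Y)))"
    by (simp add: reassoc[OF mu_natural[of _ "Y \<otimes> X" "X \<otimes> Y", symmetric]])
  \<comment> \<open>An identity is inserted as two opposite swaps: one completes the inner right
    strength, the other the outer one. The next step regroups them with the cancellation rules
    \<open>swap_simps(4,5)\<close> switched off.\<close>
  also have "\<dots> = mu E (X \<otimes> Y) \<cdot> (?f (?f (swap E Y X) \<cdot> (stT E Y X \<cdot> (swap E (?T X) Y \<cdot> swap E Y (?T X))))
      \<cdot> (stT E Y (?T X) \<cdot> swap E (?T (?T X)) Y))"
    by (simp add: T.fmap_comp del: swap_simps(5))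
  also have "\<dots> = mu E (X \<otimes> Y) \<cdot> (?f (T.rst X Y) \<cdot> T.rst (?T X) Y)"
    unfolding rstrength_def by (simp add: T.fmap_comp del: swap_simps(4,5))
  finally show ?thesis by simp
qed

text \<open>Compatibility of \<open>dlaw\<close> with the left strengths is conjugated by the
  symmetry as in \<open>rst_mu\<close>, again with a cancelling pair of swaps between inner and
  outer strength.\<close>

lemma rst_dlaw:
  assumes XY [simp]: "X \<in> Obj E" "Y \<in> Obj E"
  shows "dlaw E (X \<otimes> Y) \<cdot> (fmap (Tf E) (F.rst X Y) \<cdot> T.rst (fobj (Ff E) X) Y)
    = fmap (Ff E) (T.rst X Y) \<cdot> (F.rst (fobj (Tf E) X) Y \<cdot> (dlaw E X \<boxtimes> Id E Y))"
proof -
  let ?T = "fobj (Tf E)" and ?f = "fmap (Tf E)" and ?F = "fobj (Ff E)" and ?g = "fmap (Ff E)"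
  have st: "dlaw E (Y \<otimes> X) \<cdot> (?f (stF E Y X) \<cdot> stT E Y (?F X))
      = ?g (stT E Y X) \<cdot> (stF E Y (?T X) \<cdot> (Id E Y \<boxtimes> dlaw E X))"
    using dlaw_strength by (simp add: strength_compatible_def)
  let ?s = "swap E (?T (?F X)) Y"
  have "dlaw E (X \<otimes> Y) \<cdot> (?f (F.rst X Y) \<cdot> T.rst (?F X) Y)
      = dlaw E (X \<otimes> Y) \<cdot> (?f (?g (swap E Y X) \<cdot> (stF E Y X \<cdot> (swap E (?F X) Y \<cdot> swap E Y (?F X))))
        \<cdot> (stT E Y (?F X) \<cdot> ?s))"
    unfolding rstrength_def by (simp add: T.fmap_comp del: swap_simps(4,5))
  also have "\<dots> = dlaw E (X \<otimes> Y) \<cdot> (?f (?g (swap E Y X)) \<cdot> (?f (stF E Y X) \<cdot> (stT E Y (?F X) \<cdot> ?s)))"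
    by (simp add: T.fmap_comp)
  also have "\<dots> = ?g (?f (swap E Y X)) \<cdot> ((dlaw E (Y \<otimes> X) \<cdot> (?f (stF E Y X) \<cdot> stT E Y (?F X))) \<cdot> ?s)"
    by (simp add: reassoc[OF dlaw_natural[of _ "Y \<otimes> X" "X \<otimes> Y"]])
  also have "\<dots> = ?g (?f (swap E Y X)) \<cdot> (?g (stT E Y X) \<cdot> (stF E Y (?T X) \<cdot> ((Id E Y \<boxtimes> dlaw E X) \<cdot> ?s)))"
    unfolding st by simp
  also have "(Id E Y \<boxtimes> dlaw E X) \<cdot> ?s = swap E (?F (?T X)) Y \<cdot> (dlaw E X \<boxtimes> Id E Y)"
    by (rule swap_cross[symmetric]) simp_all
  also have "?g (?f (swap E Y X)) \<cdot> (?g (stT E Y X) \<cdot> (stF E Y (?T X) \<cdot>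
        (swap E (?F (?T X)) Y \<cdot> (dlaw E X \<boxtimes> Id E Y))))
      = ?g (?f (swap E Y X) \<cdot> (stT E Y X \<cdot> (swap E (?T X) Y \<cdot> swap E Y (?T X)))) \<cdot>
        (stF E Y (?T X) \<cdot> (swap E (?F (?T X)) Y \<cdot> (dlaw E X \<boxtimes> Id E Y)))"
    by (simp add: F.fmap_comp)
  also have "\<dots> = ?g (T.rst X Y) \<cdot> (F.rst (?T X) Y \<cdot> (dlaw E X \<boxtimes> Id E Y))"
    unfolding rstrength_def by (simp add: F.fmap_comp del: swap_simps(4,5))
  finally show ?thesis .
qed

text \<open>The symmetries between the two strengths cancel. The laws for \<open>T\<close> and
  \<open>F\<close> can therefore be applied separately inside a scheduled coalgebra.\<close>

lemma rst_FT:
  assumes XY [simp]: "X \<in> Obj E" "Y \<in> Obj E"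
  shows "rstrength E (FT E) (stFT E) X Y
    = fmap (Ff E) (T.rst X Y) \<cdot> F.rst (fobj (Tf E) X) Y"
proof -
  let ?T = "fobj (Tf E)"
  have "rstrength E (FT E) (stFT E) X Y
      = fmap (Ff E) (fmap (Tf E) (swap E Y X) \<cdot> (stT E Y X \<cdot> (swap E (?T X) Y \<cdot> swap E Y (?T X)))) \<cdot>
        (stF E Y (?T X) \<cdot> swap E (fobj (Ff E) (?T X)) Y)"
    by (simp add: rstrength_def stFT_def F.fmap_comp)
  also have "\<dots> = fmap (Ff E) (T.rst X Y) \<cdot> F.rst (?T X) Y"
    unfolding rstrength_def by (simp add: F.fmap_comp del: swap_simps(4,5))
  finally show ?thesis .
qed

section \<open>The pullback of beliefs, its decomposition, and \<open>kappa\<close>\<close>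

lemma Tbar_simps [simp]:
  assumes "f \<in> Arr E"
  shows "Tbar_obj E f \<in> Obj E"
    "iota E f \<in> Arr E" "Dom E (iota E f) = Tbar_obj E f" "Cod E (iota E f) = fobj (Tf E) (Dom E f)"
    "Tbar_arr E f \<in> Arr E" "Dom E (Tbar_arr E f) = Tbar_obj E f" "Cod E (Tbar_arr E f) = Cod E f"
  using pullbacks[of "fmap (Tf E) f" "eta E (Cod E f)"] assms
  by (simp_all add: is_pullback_def Tbar_obj_def iota_def Tbar_arr_def)

text \<open>The unit and \<open>f\<close> form a cone over the pullback by naturality of
  \<open>eta\<close>.\<close>

lemma eta_bar_simps [simp]:
  assumes "f \<in> Arr E"
  shows "eta_bar E f \<in> Arr E" "Dom E (eta_bar E f) = Dom E f" "Cod E (eta_bar E f) = Tbar_obj E f"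
    "iota E f \<cdot> eta_bar E f = eta E (Dom E f)" "Tbar_arr E f \<cdot> eta_bar E f = f"
  using into_pb_simps[of "fmap (Tf E) f" "eta E (Cod E f)" "eta E (Dom E f)" f] assms
    eta_natural[of f "Dom E f" "Cod E f"]
  by (simp_all add: eta_bar_def into_Tbar_def Tbar_obj_def iota_def Tbar_arr_def)

lemma alpha_simps [simp]:
  assumes "f \<in> Arr E" "Z = Cod E f"
  shows "alpha E Z f \<in> Arr E" "Dom E (alpha E Z f) = fobj (Tf E) (Dom E f)"
    "Cod E (alpha E Z f) = fobj (Tf E) (Tbar_obj E f)"
  using alpha assms
  by (simp_all add: belief_decomposition_def natural_def slice_def slice_forget_def fcomp_def Tbar_def)

lemma flat_alpha:
  assumes "f \<in> Hom E X Z"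
  shows "mu E X \<cdot> (fmap (Tf E) (iota E f) \<cdot> alpha E Z f) = Id E (fobj (Tf E) X)"
proof -
  have "flat E f \<cdot> alpha E Z f = Id E (fobj (Tf E) X)"
    using alpha assms unfolding belief_decomposition_def by blast
  then show ?thesis
    using assms by (auto simp: flat_def)
qed

lemma kappa_simps [simp]:
  assumes "Y \<in> Obj E"
  shows "kappa E Y \<in> Arr E" "Dom E (kappa E Y) = fobj (Tf E) (Exp E Y (Act E))"
    "Cod E (kappa E Y) = Exp E (fobj (Tf E) Y) (Act E)"
  using assms by (simp_all add: kappa_def Let_def)

text \<open>The transpose of \<open>kappa\<close> is strength followed by evaluation under
  \<open>T\<close>. Naturality of the strength moves \<open>g\<close> under \<open>T\<close>, where
  evaluation turns it into its transpose.\<close>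

lemma uncurry_kappa:
  assumes "g \<in> Hom E X (Exp E Y (Act E))" "Y \<in> Obj E"
  shows "uncurry E (Act E) (fobj (Tf E) Y) (kappa E Y \<cdot> fmap (Tf E) g)
    = fmap (Tf E) (uncurry E (Act E) Y g) \<cdot> T.rst X (Act E)"
proof -
  have X: "X \<in> Obj E"
    using assms(1) by auto
  have "uncurry E (Act E) (fobj (Tf E) Y) (kappa E Y \<cdot> fmap (Tf E) g)
      = fmap (Tf E) (Ev E Y (Act E)) \<cdot> (T.rst (Exp E Y (Act E)) (Act E) \<cdot> (fmap (Tf E) g \<boxtimes> Id E (Act E)))"
    using assms X by (simp add: uncurry_comp) (simp add: kappa_def Let_def)
  also have "\<dots> = fmap (Tf E) (uncurry E (Act E) Y g) \<cdot> T.rst X (Act E)"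
    using assms X T.rst_natural[of g X "Exp E Y (Act E)" "Id E (Act E)"]
    by (simp add: uncurry_def T.fmap_comp)
  finally show ?thesis .
qed

lemma dlaw'_simps [simp]:
  assumes "X \<in> Obj E"
  shows "dlaw' E X \<in> Arr E" "Dom E (dlaw' E X) = fobj (Tf E) (Exp E (fobj (Ff E) X) (Act E))"
    "Cod E (dlaw' E X) = Exp E (fobj (Ff E) (fobj (Tf E) X)) (Act E)"
  using assms by (simp_all add: dlaw'_def)

section \<open>Bottom arrows and iterates of \<open>Phi\<close>\<close>

lemma bot_arr_simps [simp]:
  assumes "X \<in> Obj E"
  shows "bot_arr E X \<in> Arr E" "Dom E (bot_arr E X) = X" "Cod E (bot_arr E X) = Omega E"
proof -
  interpret complete_lattice "hom_lattice E X"
    using Omega assms by (simp add: ordered_object_def hom_lattice_def)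
  have "bot_arr E X \<in> Hom E X (Omega E)"
    using bottom_closed by (simp add: bot_arr_def hom_lattice_def hom_order_def)
  then show "bot_arr E X \<in> Arr E" "Dom E (bot_arr E X) = X" "Cod E (bot_arr E X) = Omega E"
    by simp_all
qed

text \<open>Bottom is the join of the empty set, and precomposition preserves all joins, the empty
  one included.\<close>

lemma bot_arr_comp:
  assumes "h \<in> Hom E Y X"
  shows "bot_arr E X \<cdot> h = bot_arr E Y"
proof -
  have *: "\<Squnion>\<^bsub>hom_lattice E Z\<^esub> {} = bot_arr E Z" if "Z \<in> Obj E" for Z
  proof -
    interpret complete_lattice "hom_lattice E Z"
      using Omega that by (simp add: ordered_object_def hom_lattice_def)
    show ?thesis
      using weak_sup_empty by (simp add: bot_arr_def hom_lattice_def hom_order_def)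
  qed
  have "(\<Squnion>\<^bsub>hom_lattice E X\<^esub> {}) \<cdot> h = \<Squnion>\<^bsub>hom_lattice E Y\<^esub> {}"
    using Omega assms unfolding ordered_object_def hom_lattice_def by (metis empty_subsetI image_empty)
  then show ?thesis
    using assms by (auto simp: *)
qed

lemma Phi_pow_simps [simp]:
  assumes "e \<in> Arr E" "Cod E e = fobj (FT E) (Dom E e)" "X = Dom E e"
  shows "(Phi E e ^^ n) (bot_arr E X) \<in> Arr E"
    "Dom E ((Phi E e ^^ n) (bot_arr E X)) = X"
    "Cod E ((Phi E e ^^ n) (bot_arr E X)) = Omega E"
proof -
  have "tau E \<in> Hom E (fobj (FT E) (Omega E)) (Omega E)"
    using tau by (simp add: monotone_algebra_def)
  then have "(Phi E e ^^ n) (bot_arr E X) \<in> Hom E X (Omega E)"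
    using assms by (induction n) (simp_all add: Phi_def)
  then show "(Phi E e ^^ n) (bot_arr E X) \<in> Arr E"
    "Dom E ((Phi E e ^^ n) (bot_arr E X)) = X"
    "Cod E ((Phi E e ^^ n) (bot_arr E X)) = Omega E"
    by simp_all
qed

end

section \<open>Scheduled belief coalgebras\<close>

locale pcoalgebra = setting E for E :: "('o, 'm) setting" (structure) +
  fixes K :: "('o, 'm) pcoalg"
  assumes pcoalg: "is_pcoalg E K"
begin

text \<open>An element of \<open>hist\<close> is the scheduler still to be followed: an action for
  every word of further observations. After the action at the empty word is taken,
  \<open>tail\<close> remains; \<open>update\<close> feeds it the observation of the new state and
  so returns to \<open>hist\<close>.\<close>

abbreviation "hist \<equiv> Exp E (Act E) (star_obj E (Obs K))"
abbreviation "tail \<equiv> Exp E (Act E) (plus_obj E (Obs K))"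
abbreviation "step \<equiv> uncurry E (Act E) (fobj (Ff E) (fobj (Tf E) (State K))) (delta E K)"
abbreviation "split_state \<equiv>
  assocl E (State K) (Act E) tail \<cdot> (Id E (State K) \<boxtimes> split_exp E (Act E) (Obs K))"
abbreviation "update \<equiv>
  \<langle>P1 E (State K) tail, ev_cons E (Act E) (Obs K) \<cdot> (obs E K \<boxtimes> Id E tail)\<rangle>"

lemma pcoalg_simps [simp]:
  "State K \<in> Obj E" "Obs K \<in> Obj E"
  "point K \<in> Arr E" "Dom E (point K) = Init E" "Cod E (point K) = State K"
  "struct K \<in> Arr E" "Dom E (struct K) = State K"
  "delta E K \<in> Arr E" "Dom E (delta E K) = State K"
  "Cod E (delta E K) = Exp E (fobj (Ff E) (fobj (Tf E) (State K))) (Act E)"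
  "obs E K \<in> Arr E" "Dom E (obs E K) = State K" "Cod E (obs E K) = Obs K"
  using pcoalg by (simp_all add: is_pcoalg_def delta_def obs_def)

lemma Sch_eq:
  "Sch E K = fmap (Ff E) (fmap (Tf E) update \<cdot> T.rst (State K) tail) \<cdot>
     (F.rst (fobj (Tf E) (State K)) tail \<cdot> ((step \<boxtimes> Id E tail) \<cdot> split_state))"
  by (simp add: Sch_def Let_def rst_FT F.fmap_comp)

lemma Sch_simps [simp]:
  "Sch E K \<in> Arr E" "Dom E (Sch E K) = State K \<otimes> hist"
  "Cod E (Sch E K) = fobj (Ff E) (fobj (Tf E) (State K \<otimes> hist))"
  by (simp_all add: Sch_eq)

abbreviation "belief \<equiv> Tbar_obj E (obs E K)"
abbreviation "belief_obs \<equiv> Tbar_arr E (obs E K)"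
abbreviation "\<iota> \<equiv> iota E (obs E K)"

lemma bel_trans_simps [simp]:
  "bel_trans E K \<in> Arr E" "Dom E (bel_trans E K) = belief"
  "Cod E (bel_trans E K) = Exp E (fobj (Ff E) (fobj (Tf E) belief)) (Act E)"
  by (simp_all add: bel_trans_def)

lemma Bel_simps [simp]:
  "State (Bel E K) = belief" "Obs (Bel E K) = Obs K"
  "point (Bel E K) = eta_bar E (obs E K) \<cdot> point K"
  "delta E (Bel E K) = bel_trans E K" "obs E (Bel E K) = belief_obs"
  by (simp_all add: delta_def[of E "Bel E K"] obs_def[of E "Bel E K"]) (simp_all add: Bel_def)

text \<open>Allows the locale to be interpreted a second time at \<open>Bel E K\<close>, so that the
  facts about \<open>Sch\<close> also cover the belief coalgebra.\<close>

lemma is_pcoalg_Bel: "is_pcoalg E (Bel E K)"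
  by (simp add: is_pcoalg_def) (simp add: Bel_def)

text \<open>Under transposition each \<open>exp_map\<close> becomes postcomposition and
  \<open>kappa\<close> becomes the strength of \<open>T\<close>, which leaves a plain composite to
  which the strength laws apply.\<close>

lemma uncurry_bel_trans:
  "uncurry E (Act E) (fobj (Ff E) (fobj (Tf E) belief)) (bel_trans E K)
    = fmap (Ff E) (alpha E (Obs K) (obs E K)) \<cdot> (fmap (Ff E) (mu E (State K)) \<cdot>
        (dlaw E (fobj (Tf E) (State K)) \<cdot> (fmap (Tf E) step \<cdot>
          (T.rst (State K) (Act E) \<cdot> (\<iota> \<boxtimes> Id E (Act E))))))"
proof -
  let ?FT = "fobj (Ff E) (fobj (Tf E) (State K))"
  have "uncurry E (Act E) (fobj (Tf E) ?FT) (kappa E ?FT \<cdot> (fmap (Tf E) (delta E K) \<cdot> \<iota>))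
      = uncurry E (Act E) (fobj (Tf E) ?FT) (kappa E ?FT \<cdot> fmap (Tf E) (delta E K)) \<cdot> (\<iota> \<boxtimes> Id E (Act E))"
    using uncurry_comp[of "kappa E ?FT \<cdot> fmap (Tf E) (delta E K)" \<iota>] by simp
  also have "\<dots> = fmap (Tf E) step \<cdot> (T.rst (State K) (Act E) \<cdot> (\<iota> \<boxtimes> Id E (Act E)))"
    by (simp add: uncurry_kappa[where X = "State K"])
  finally have "uncurry E (Act E) (fobj (Tf E) ?FT) (kappa E ?FT \<cdot> (fmap (Tf E) (delta E K) \<cdot> \<iota>))
      = fmap (Tf E) step \<cdot> (T.rst (State K) (Act E) \<cdot> (\<iota> \<boxtimes> Id E (Act E)))" .
  then show ?thesis
    by (simp add: bel_trans_def dlaw'_def uncurry_exp_map)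
qed

text \<open>Here assumption (2) enters. Advancing the scheduler by the observation stored in a
  belief and then drawing a state agrees with drawing the state first and advancing by the
  observation of that state.\<close>

lemma rst_update:
  assumes obs_known: "fmap (Tf E) \<langle>Id E (State K), obs E K\<rangle> \<cdot> \<iota>
      = T.rst (State K) (Obs K) \<cdot> \<langle>\<iota>, belief_obs\<rangle>"
  shows "T.rst (State K) hist \<cdot> ((\<iota> \<boxtimes> Id E hist) \<cdot>
        \<langle>P1 E belief tail, ev_cons E (Act E) (Obs K) \<cdot> (belief_obs \<boxtimes> Id E tail)\<rangle>)
      = fmap (Tf E) update \<cdot> (T.rst (State K) tail \<cdot> (\<iota> \<boxtimes> Id E tail))"
proof -
  let ?S = "State K" and ?O = "Obs K" and ?ev = "ev_cons E (Act E) (Obs K)"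
  let ?T = "fobj (Tf E)" and ?f = "fmap (Tf E)"
  \<comment> \<open>The pair \<open>\<langle>\<iota>, belief_obs\<rangle>\<close> is factored out so
    that \<open>obs_known\<close> can apply. The identity is written as \<open>?f (Id E ?S)\<close>
    to match naturality of the strength, hence the later \<open>del: T.fmap_Id\<close>.\<close>
  have "(\<iota> \<boxtimes> Id E hist) \<cdot> \<langle>P1 E belief tail, ?ev \<cdot> (belief_obs \<boxtimes> Id E tail)\<rangle>
      = (?f (Id E ?S) \<boxtimes> ?ev) \<cdot> (assocr E (?T ?S) ?O tail \<cdot> (\<langle>\<iota>, belief_obs\<rangle> \<boxtimes> Id E tail))"
    by (simp add: to_pairs)
  then have "T.rst ?S hist \<cdot> ((\<iota> \<boxtimes> Id E hist) \<cdot>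
        \<langle>P1 E belief tail, ?ev \<cdot> (belief_obs \<boxtimes> Id E tail)\<rangle>)
      = ?f (Id E ?S \<boxtimes> ?ev) \<cdot> (T.rst ?S (?O \<otimes> tail) \<cdot>
          (assocr E (?T ?S) ?O tail \<cdot> (\<langle>\<iota>, belief_obs\<rangle> \<boxtimes> Id E tail)))"
    by (simp add: reassoc[OF T.rst_natural[where X = ?S and Y = "?O \<otimes> tail"]] del: T.fmap_Id)
  also have "\<dots> = ?f (Id E ?S \<boxtimes> ?ev) \<cdot> (?f (assocr E ?S ?O tail) \<cdot> (T.rst (?S \<otimes> ?O) tail \<cdot>
      ((T.rst ?S ?O \<boxtimes> Id E tail) \<cdot> (\<langle>\<iota>, belief_obs\<rangle> \<boxtimes> Id E tail))))"
    by (simp add: reassoc[OF T.rst_assoc])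
  also have "(T.rst ?S ?O \<boxtimes> Id E tail) \<cdot> (\<langle>\<iota>, belief_obs\<rangle> \<boxtimes> Id E tail)
      = (?f \<langle>Id E ?S, obs E K\<rangle> \<boxtimes> Id E tail) \<cdot> (\<iota> \<boxtimes> Id E tail)"
    by (simp add: cross_comp obs_known)
  also have "?f (Id E ?S \<boxtimes> ?ev) \<cdot> (?f (assocr E ?S ?O tail) \<cdot> (T.rst (?S \<otimes> ?O) tail \<cdot>
        ((?f \<langle>Id E ?S, obs E K\<rangle> \<boxtimes> Id E tail) \<cdot> (\<iota> \<boxtimes> Id E tail))))
      = ?f ((Id E ?S \<boxtimes> ?ev) \<cdot> (assocr E ?S ?O tail \<cdot> (\<langle>Id E ?S, obs E K\<rangle> \<boxtimes> Id E tail))) \<cdot>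
          (T.rst ?S tail \<cdot> (\<iota> \<boxtimes> Id E tail))"
    by (simp add: reassoc[OF T.rst_natural[where X = ?S and Y = tail]] T.fmap_comp)
  also have "(Id E ?S \<boxtimes> ?ev) \<cdot> (assocr E ?S ?O tail \<cdot> (\<langle>Id E ?S, obs E K\<rangle> \<boxtimes> Id E tail)) = update"
    by (simp add: to_pairs)
  finally show ?thesis .
qed

text \<open>The decomposition \<open>\<alpha>\<close> is undone by flattening, so it disappears from the composite.\<close>

lemma mu_rst_update_alpha:
  assumes obs_known: "fmap (Tf E) \<langle>Id E (State K), obs E K\<rangle> \<cdot> \<iota>
      = T.rst (State K) (Obs K) \<cdot> \<langle>\<iota>, belief_obs\<rangle>"
  shows "mu E (State K \<otimes> hist) \<cdot> (fmap (Tf E) (T.rst (State K) hist \<cdot> ((\<iota> \<boxtimes> Id E hist) \<cdot>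
        \<langle>P1 E belief tail, ev_cons E (Act E) (Obs K) \<cdot> (belief_obs \<boxtimes> Id E tail)\<rangle>)) \<cdot>
        (T.rst belief tail \<cdot> (alpha E (Obs K) (obs E K) \<boxtimes> Id E tail)))
      = fmap (Tf E) update \<cdot> T.rst (State K) tail"
proof -
  let ?S = "State K" and ?T = "fobj (Tf E)" and ?f = "fmap (Tf E)"
  let ?\<alpha> = "alpha E (Obs K) (obs E K)"
  have "mu E (?S \<otimes> hist) \<cdot> (?f (T.rst ?S hist \<cdot> ((\<iota> \<boxtimes> Id E hist) \<cdot>
        \<langle>P1 E belief tail, ev_cons E (Act E) (Obs K) \<cdot> (belief_obs \<boxtimes> Id E tail)\<rangle>)) \<cdot>
        (T.rst belief tail \<cdot> (?\<alpha> \<boxtimes> Id E tail)))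
      = mu E (?S \<otimes> hist) \<cdot> (?f (?f update) \<cdot> (?f (T.rst ?S tail) \<cdot>
          (?f (\<iota> \<boxtimes> Id E tail) \<cdot> (T.rst belief tail \<cdot> (?\<alpha> \<boxtimes> Id E tail)))))"
    unfolding rst_update[OF obs_known] by (simp add: T.fmap_comp)
  also have "\<dots> = ?f update \<cdot> (mu E (?S \<otimes> tail) \<cdot> (?f (T.rst ?S tail) \<cdot>
          (?f (\<iota> \<boxtimes> Id E tail) \<cdot> (T.rst belief tail \<cdot> (?\<alpha> \<boxtimes> Id E tail)))))"
    by (simp add: reassoc[OF mu_natural[where X = "?S \<otimes> tail" and Y = "?S \<otimes> hist"]])
  also have "?f (\<iota> \<boxtimes> Id E tail) \<cdot> (T.rst belief tail \<cdot> (?\<alpha> \<boxtimes> Id E tail))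
      = T.rst (?T ?S) tail \<cdot> ((?f \<iota> \<boxtimes> Id E tail) \<cdot> (?\<alpha> \<boxtimes> Id E tail))"
    by (simp add: reassoc[OF T.rst_natural[where X = belief and Y = tail]])
  also have "(?f \<iota> \<boxtimes> Id E tail) \<cdot> (?\<alpha> \<boxtimes> Id E tail) = (?f \<iota> \<cdot> ?\<alpha>) \<boxtimes> Id E tail"
    by (simp add: cross_comp)
  also have "mu E (?S \<otimes> tail) \<cdot> (?f (T.rst ?S tail) \<cdot>
        (T.rst (?T ?S) tail \<cdot> ((?f \<iota> \<cdot> ?\<alpha>) \<boxtimes> Id E tail)))
      = (mu E (?S \<otimes> tail) \<cdot> (?f (T.rst ?S tail) \<cdot> T.rst (?T ?S) tail)) \<cdot> ((?f \<iota> \<cdot> ?\<alpha>) \<boxtimes> Id E tail)"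
    by simp
  \<comment> \<open>By \<open>rst_mu\<close> the multiplication lands next to
    \<open>?f \<iota> \<cdot> ?\<alpha>\<close>, and \<open>flat_alpha\<close> reduces the three to
    an identity.\<close>
  also have "\<dots> = T.rst ?S tail"
    unfolding rst_mu[OF pcoalg_simps(1) Exp_simps(1)[OF Act_Obj star_plus_simps(2)[OF pcoalg_simps(2)]]]
    by (simp add: cross_comp flat_alpha) (simp add: cross_def)
  finally show ?thesis .
qed

text \<open>Up to flattening,
  \<open>T.rst (State K) hist \<cdot> (\<iota> \<boxtimes> Id E hist)\<close> respects the dynamics:
  the scheduled belief step matches the original scheduled step run under \<open>T\<close> and
  lifted by \<open>dlaw\<close> and \<open>mu\<close>, as in a generalized powerset
  construction.\<close>

lemma Sch_Bel:
  assumes obs_known: "fmap (Tf E) \<langle>Id E (State K), obs E K\<rangle> \<cdot> \<iota>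
      = T.rst (State K) (Obs K) \<cdot> \<langle>\<iota>, belief_obs\<rangle>"
  shows "fmap (Ff E) (mu E (State K \<otimes> hist) \<cdot>
          fmap (Tf E) (T.rst (State K) hist \<cdot> (\<iota> \<boxtimes> Id E hist))) \<cdot> Sch E (Bel E K)
    = fmap (Ff E) (mu E (State K \<otimes> hist)) \<cdot> (dlaw E (fobj (Tf E) (State K \<otimes> hist)) \<cdot>
        (fmap (Tf E) (Sch E K) \<cdot> (T.rst (State K) hist \<cdot> (\<iota> \<boxtimes> Id E hist))))"
    (is "?lhs = ?rhs")
proof -
  let ?S = "State K" and ?A = "Act E" and ?O = "Obs K"
  let ?T = "fobj (Tf E)" and ?f = "fmap (Tf E)" and ?F = "fobj (Ff E)" and ?g = "fmap (Ff E)"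
  let ?I = "Id E tail" and ?\<alpha> = "alpha E (Obs K) (obs E K)"
  let ?D = "?f step \<cdot> (T.rst ?S ?A \<cdot> (\<iota> \<boxtimes> Id E ?A))"
  let ?m = "?g (mu E ?S) \<cdot> (dlaw E (?T ?S) \<cdot> ?D)"
  let ?split = "assocl E belief ?A tail \<cdot> (Id E belief \<boxtimes> split_exp E ?A ?O)"
  let ?q = "\<langle>P1 E belief tail, ev_cons E ?A ?O \<cdot> (belief_obs \<boxtimes> ?I)\<rangle>"
  \<comment> \<open>The form to which both sides are brought: \<open>?m\<close> is the transposed
    belief transition before \<open>\<alpha>\<close> is applied, and it is followed by the strengths
    and \<open>update\<close> of the original coalgebra.\<close>
  let ?common = "?g (?f update) \<cdot> (?g (T.rst ?S tail) \<cdot> (F.rst (?T ?S) tail \<cdot> ((?m \<boxtimes> ?I) \<cdot> ?split)))"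
  interpret B: pcoalgebra E "Bel E K"
    by unfold_locales (rule is_pcoalg_Bel)

  have "?lhs = ?g (mu E (?S \<otimes> hist) \<cdot> ?f (T.rst ?S hist \<cdot> (\<iota> \<boxtimes> Id E hist))) \<cdot>
      (?g (?f ?q \<cdot> T.rst belief tail) \<cdot> (F.rst (?T belief) tail \<cdot> (((?g ?\<alpha> \<cdot> ?m) \<boxtimes> ?I) \<cdot> ?split)))"
    unfolding B.Sch_eq by (simp add: uncurry_bel_trans)
  also have "(?g ?\<alpha> \<cdot> ?m) \<boxtimes> ?I = (?g ?\<alpha> \<boxtimes> ?I) \<cdot> (?m \<boxtimes> ?I)"
    by (simp add: cross_comp)
  \<comment> \<open>The decomposition passes through the strength of \<open>F\<close> so as to meet
    the update of the belief coalgebra, where \<open>mu_rst_update_alpha\<close> removes it.\<close>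
  also have "F.rst (?T belief) tail \<cdot> (((?g ?\<alpha> \<boxtimes> ?I) \<cdot> (?m \<boxtimes> ?I)) \<cdot> ?split)
      = ?g (?\<alpha> \<boxtimes> ?I) \<cdot> (F.rst (?T ?S) tail \<cdot> ((?m \<boxtimes> ?I) \<cdot> ?split))"
    by (simp add: reassoc[OF F.rst_natural[where X = "?T ?S" and Y = tail]])
  also have "?g (mu E (?S \<otimes> hist) \<cdot> ?f (T.rst ?S hist \<cdot> (\<iota> \<boxtimes> Id E hist))) \<cdot>
      (?g (?f ?q \<cdot> T.rst belief tail) \<cdot> (?g (?\<alpha> \<boxtimes> ?I) \<cdot> (F.rst (?T ?S) tail \<cdot> ((?m \<boxtimes> ?I) \<cdot> ?split))))
    = ?g (mu E (?S \<otimes> hist) \<cdot> (?f (T.rst ?S hist \<cdot> ((\<iota> \<boxtimes> Id E hist) \<cdot> ?q)) \<cdot>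
        (T.rst belief tail \<cdot> (?\<alpha> \<boxtimes> ?I)))) \<cdot> (F.rst (?T ?S) tail \<cdot> ((?m \<boxtimes> ?I) \<cdot> ?split))"
    by (simp add: F.fmap_comp T.fmap_comp del: pair_comp)
  also have "\<dots> = ?common"
    unfolding mu_rst_update_alpha[OF obs_known] by (simp add: F.fmap_comp)
  finally have lhs: "?lhs = ?common" .

  let ?R = "(?f step \<boxtimes> ?I) \<cdot> ((T.rst ?S ?A \<boxtimes> ?I) \<cdot> (assocl E (?T ?S) ?A tail \<cdot>
      ((Id E (?T ?S) \<boxtimes> split_exp E ?A ?O) \<cdot> (\<iota> \<boxtimes> Id E hist))))"
  have "?f (Sch E K) \<cdot> (T.rst ?S hist \<cdot> (\<iota> \<boxtimes> Id E hist))
      = ?f (?g (?f update)) \<cdot> (?f (?g (T.rst ?S tail)) \<cdot> (?f (F.rst (?T ?S) tail) \<cdot> (?f (step \<boxtimes> ?I) \<cdot>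
        (?f (assocl E ?S ?A tail) \<cdot> (?f (Id E ?S \<boxtimes> split_exp E ?A ?O) \<cdot>
          (T.rst ?S hist \<cdot> (\<iota> \<boxtimes> Id E hist)))))))"
    by (simp add: Sch_eq F.fmap_comp T.fmap_comp)
  also have "?f (Id E ?S \<boxtimes> split_exp E ?A ?O) \<cdot> (T.rst ?S hist \<cdot> (\<iota> \<boxtimes> Id E hist))
      = T.rst ?S (?A \<otimes> tail) \<cdot> ((Id E (?T ?S) \<boxtimes> split_exp E ?A ?O) \<cdot> (\<iota> \<boxtimes> Id E hist))"
    using T.rst_natural[of "Id E ?S" ?S ?S "split_exp E ?A ?O" hist "?A \<otimes> tail"]
    by (simp flip: assoc)
  also have "?f (assocl E ?S ?A tail) \<cdot> (T.rst ?S (?A \<otimes> tail) \<cdot>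
        ((Id E (?T ?S) \<boxtimes> split_exp E ?A ?O) \<cdot> (\<iota> \<boxtimes> Id E hist)))
      = T.rst (?S \<otimes> ?A) tail \<cdot> ((T.rst ?S ?A \<boxtimes> ?I) \<cdot> (assocl E (?T ?S) ?A tail \<cdot>
        ((Id E (?T ?S) \<boxtimes> split_exp E ?A ?O) \<cdot> (\<iota> \<boxtimes> Id E hist))))"
    by (simp add: reassoc[OF T.rst_assocl])
  also have "?f (step \<boxtimes> ?I) \<cdot> (T.rst (?S \<otimes> ?A) tail \<cdot> ((T.rst ?S ?A \<boxtimes> ?I) \<cdot>
        (assocl E (?T ?S) ?A tail \<cdot> ((Id E (?T ?S) \<boxtimes> split_exp E ?A ?O) \<cdot> (\<iota> \<boxtimes> Id E hist)))))
      = T.rst (?F (?T ?S)) tail \<cdot> ?R"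
    by (simp add: reassoc[OF T.rst_natural[of step "?S \<otimes> ?A" "?F (?T ?S)" ?I tail tail, symmetric]])
  finally have "?rhs = ?g (mu E (?S \<otimes> hist)) \<cdot> (dlaw E (?T (?S \<otimes> hist)) \<cdot> (?f (?g (?f update)) \<cdot>
      (?f (?g (T.rst ?S tail)) \<cdot> (?f (F.rst (?T ?S) tail) \<cdot> (T.rst (?F (?T ?S)) tail \<cdot> ?R)))))"
    by simp
  \<comment> \<open>Two naturality steps, past \<open>update\<close> and past the strength of
    \<open>T\<close>, bring \<open>dlaw\<close> to where \<open>rst_dlaw\<close> applies.\<close>
  also have "\<dots> = ?g (mu E (?S \<otimes> hist)) \<cdot> (?g (?f (?f update)) \<cdot> (dlaw E (?T (?S \<otimes> tail)) \<cdot>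
      (?f (?g (T.rst ?S tail)) \<cdot> (?f (F.rst (?T ?S) tail) \<cdot> (T.rst (?F (?T ?S)) tail \<cdot> ?R)))))"
    by (simp add: reassoc[OF dlaw_natural[of "?f update" "?T (?S \<otimes> tail)" "?T (?S \<otimes> hist)"]])
  also have "\<dots> = ?g (mu E (?S \<otimes> hist) \<cdot> ?f (?f update)) \<cdot> (?g (?f (T.rst ?S tail)) \<cdot>
      ((dlaw E (?T ?S \<otimes> tail) \<cdot> (?f (F.rst (?T ?S) tail) \<cdot> T.rst (?F (?T ?S)) tail)) \<cdot> ?R))"
    by (simp add: F.fmap_comp
        reassoc[OF dlaw_natural[of "T.rst ?S tail" "?T ?S \<otimes> tail" "?T (?S \<otimes> tail)"]])
  also have "mu E (?S \<otimes> hist) \<cdot> ?f (?f update) = ?f update \<cdot> mu E (?S \<otimes> tail)"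
    by (rule mu_natural) simp
  also have "dlaw E (?T ?S \<otimes> tail) \<cdot> (?f (F.rst (?T ?S) tail) \<cdot> T.rst (?F (?T ?S)) tail)
      = ?g (T.rst (?T ?S) tail) \<cdot> (F.rst (?T (?T ?S)) tail \<cdot> (dlaw E (?T ?S) \<boxtimes> ?I))"
    by (rule rst_dlaw) simp_all
  also have "?g (?f update \<cdot> mu E (?S \<otimes> tail)) \<cdot> (?g (?f (T.rst ?S tail)) \<cdot>
        ((?g (T.rst (?T ?S) tail) \<cdot> (F.rst (?T (?T ?S)) tail \<cdot> (dlaw E (?T ?S) \<boxtimes> ?I))) \<cdot> ?R))
      = ?g (?f update) \<cdot> (?g (mu E (?S \<otimes> tail) \<cdot> (?f (T.rst ?S tail) \<cdot> T.rst (?T ?S) tail)) \<cdot>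
        (F.rst (?T (?T ?S)) tail \<cdot> ((dlaw E (?T ?S) \<boxtimes> ?I) \<cdot> ?R)))"
    by (simp add: F.fmap_comp)
  also have "mu E (?S \<otimes> tail) \<cdot> (?f (T.rst ?S tail) \<cdot> T.rst (?T ?S) tail)
      = T.rst ?S tail \<cdot> (mu E ?S \<boxtimes> ?I)"
    by (rule rst_mu) simp_all
  also have "?g (?f update) \<cdot> (?g (T.rst ?S tail \<cdot> (mu E ?S \<boxtimes> ?I)) \<cdot>
        (F.rst (?T (?T ?S)) tail \<cdot> ((dlaw E (?T ?S) \<boxtimes> ?I) \<cdot> ?R)))
      = ?g (?f update) \<cdot> (?g (T.rst ?S tail) \<cdot> (F.rst (?T ?S) tail \<cdot>
        ((?g (mu E ?S) \<boxtimes> ?I) \<cdot> ((dlaw E (?T ?S) \<boxtimes> ?I) \<cdot> ?R))))"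
    by (simp add: F.fmap_comp
        reassoc[OF F.rst_natural[of "mu E ?S" "?T (?T ?S)" "?T ?S" ?I tail tail, symmetric]])
  \<comment> \<open>The maps \<open>\<iota>\<close> and \<open>split_exp\<close> act on different
    factors and so commute; the rest is coherence of products.\<close>
  also have "(?g (mu E ?S) \<boxtimes> ?I) \<cdot> ((dlaw E (?T ?S) \<boxtimes> ?I) \<cdot> ?R) = (?m \<boxtimes> ?I) \<cdot> ?split"
    by (simp add: to_pairs)
  finally show ?thesis
    unfolding lhs by simp
qed

text \<open>Averaging with \<open>\<sigma>\<close> commutes with one step of \<open>Phi\<close> and
  preserves bottom, hence commutes with every finite iterate. The relation is thus established
  before any join is taken.\<close>

lemma Phi_Sch_Bel:
  assumes obs_known: "fmap (Tf E) \<langle>Id E (State K), obs E K\<rangle> \<cdot> \<iota>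
      = T.rst (State K) (Obs K) \<cdot> \<langle>\<iota>, belief_obs\<rangle>"
    and \<rho>: "\<rho> \<in> Hom E (fobj (Ff E) (Omega E)) (Omega E)"
    and \<sigma>: "EM_algebra E (Tf E) (eta E) (mu E) (Omega E) \<sigma>"
    and tau_eq: "tau E = \<rho> \<cdot> fmap (Ff E) \<sigma>"
    and dist: "\<sigma> \<cdot> fmap (Tf E) \<rho> = \<rho> \<cdot> fmap (Ff E) \<sigma> \<cdot> dlaw E (Omega E)"
    and bot: "\<forall>X\<in>Obj E. bot_arr E (fobj (Tf E) X) = \<sigma> \<cdot> fmap (Tf E) (bot_arr E X)"
  shows "(Phi E (Sch E (Bel E K)) ^^ n) (bot_arr E (belief \<otimes> hist))
    = \<sigma> \<cdot> (fmap (Tf E) ((Phi E (Sch E K) ^^ n) (bot_arr E (State K \<otimes> hist))) \<cdot>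
        (T.rst (State K) hist \<cdot> (\<iota> \<boxtimes> Id E hist)))"
proof (induction n)
  let ?r = "T.rst (State K) hist \<cdot> (\<iota> \<boxtimes> Id E hist)"
  case 0
  have "\<sigma> \<cdot> (fmap (Tf E) (bot_arr E (State K \<otimes> hist)) \<cdot> ?r)
      = bot_arr E (fobj (Tf E) (State K \<otimes> hist)) \<cdot> ?r"
    using \<sigma> Omega by (subst bot[rule_format]) (simp_all add: EM_algebra_def ordered_object_def)
  also have "\<dots> = bot_arr E (belief \<otimes> hist)"
    by (rule bot_arr_comp) simp
  finally show ?case by simp
next
  case (Suc n)
  let ?\<Omega> = "Omega E" and ?T = "fobj (Tf E)" and ?f = "fmap (Tf E)" and ?g = "fmap (Ff E)"
  let ?r = "T.rst (State K) hist \<cdot> (\<iota> \<boxtimes> Id E hist)" and ?X = "State K \<otimes> hist"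
  define v where "v = (Phi E (Sch E K) ^^ n) (bot_arr E ?X)"
  interpret B: pcoalgebra E "Bel E K"
    by unfold_locales (rule is_pcoalg_Bel)
  have [simp]: "?\<Omega> \<in> Obj E" "\<sigma> \<in> Arr E" "Dom E \<sigma> = ?T ?\<Omega>" "Cod E \<sigma> = ?\<Omega>"
      "\<rho> \<in> Arr E" "Dom E \<rho> = fobj (Ff E) ?\<Omega>" "Cod E \<rho> = ?\<Omega>"
      "v \<in> Arr E" "Dom E v = ?X" "Cod E v = ?\<Omega>"
    using \<rho> \<sigma> Omega by (simp_all add: EM_algebra_def ordered_object_def v_def)
  have [simp]: "Sch E (Bel E K) \<in> Arr E" "Dom E (Sch E (Bel E K)) = belief \<otimes> hist"
      "Cod E (Sch E (Bel E K)) = fobj (Ff E) (?T (belief \<otimes> hist))"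
    using B.Sch_simps by simp_all
  have \<sigma>_mu: "\<sigma> \<cdot> ?f \<sigma> = \<sigma> \<cdot> mu E ?\<Omega>"
    using \<sigma> by (simp add: EM_algebra_def)
  \<comment> \<open>The Eilenberg-Moore law and naturality of \<open>mu\<close>, used twice below:
    forwards to expose the \<open>mu\<close> that \<open>Sch_Bel\<close> requires, then backwards to
    recover the inner \<open>\<sigma>\<close> that has to pass through \<open>dlaw\<close>.\<close>
  have step: "\<rho> \<cdot> (?g \<sigma> \<cdot> (?g (?f \<sigma>) \<cdot> (?g (?f (?f v)) \<cdot> k)))
      = \<rho> \<cdot> (?g \<sigma> \<cdot> (?g (?f v) \<cdot> (?g (mu E ?X) \<cdot> k)))"
    if "k \<in> Hom E Y (fobj (Ff E) (?T (?T ?X)))" for k Y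
  proof -
    have "?g \<sigma> \<cdot> (?g (?f \<sigma>) \<cdot> (?g (?f (?f v)) \<cdot> k)) = ?g ((\<sigma> \<cdot> ?f \<sigma>) \<cdot> ?f (?f v)) \<cdot> k"
      using that by (simp add: F.fmap_comp)
    also have "\<dots> = ?g (\<sigma> \<cdot> (mu E ?\<Omega> \<cdot> ?f (?f v))) \<cdot> k"
      by (simp add: \<sigma>_mu)
    also have "\<dots> = ?g \<sigma> \<cdot> (?g (?f v) \<cdot> (?g (mu E ?X) \<cdot> k))"
      using that by (simp add: mu_natural[where X = ?X] F.fmap_comp)
    finally show ?thesis by simp
  qed
  have "(Phi E (Sch E (Bel E K)) ^^ Suc n) (bot_arr E (belief \<otimes> hist))
      = \<rho> \<cdot> (?g \<sigma> \<cdot> (?g (?f (\<sigma> \<cdot> (?f v \<cdot> ?r))) \<cdot> Sch E (Bel E K)))"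
    unfolding funpow.simps comp_apply Suc.IH v_def[symmetric] by (simp add: Phi_def tau_eq)
  also have "\<dots> = \<rho> \<cdot> (?g \<sigma> \<cdot> (?g (?f \<sigma>) \<cdot> (?g (?f (?f v)) \<cdot> (?g (?f ?r) \<cdot> Sch E (Bel E K)))))"
    by (simp add: T.fmap_comp F.fmap_comp)
  also have "\<dots> = \<rho> \<cdot> (?g \<sigma> \<cdot> (?g (?f v) \<cdot> (?g (mu E ?X) \<cdot> (?g (?f ?r) \<cdot> Sch E (Bel E K)))))"
    by (rule step[where Y = "belief \<otimes> hist"]) simp
  also have "?g (mu E ?X) \<cdot> (?g (?f ?r) \<cdot> Sch E (Bel E K))
      = ?g (mu E ?X) \<cdot> (dlaw E (?T ?X) \<cdot> (?f (Sch E K) \<cdot> ?r))"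
    using Sch_Bel[OF obs_known] by (simp add: F.fmap_comp)
  also have "\<rho> \<cdot> (?g \<sigma> \<cdot> (?g (?f v) \<cdot> (?g (mu E ?X) \<cdot> (dlaw E (?T ?X) \<cdot> (?f (Sch E K) \<cdot> ?r)))))
      = \<rho> \<cdot> (?g \<sigma> \<cdot> (?g (?f \<sigma>) \<cdot> (?g (?f (?f v)) \<cdot> (dlaw E (?T ?X) \<cdot> (?f (Sch E K) \<cdot> ?r)))))"
    by (rule step[where Y = "belief \<otimes> hist", symmetric]) simp
  also have "\<dots> = \<rho> \<cdot> (?g \<sigma> \<cdot> (dlaw E ?\<Omega> \<cdot> (?f (?g \<sigma>) \<cdot> (?f (?g (?f v)) \<cdot> (?f (Sch E K) \<cdot> ?r)))))"
    by (simp add: reassoc[OF dlaw_natural[of \<sigma> "?T ?\<Omega>" ?\<Omega>]]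
        reassoc[OF dlaw_natural[of "?f v" "?T ?X" "?T ?\<Omega>"]])
  \<comment> \<open>Read from right to left, \<open>dist\<close> exchanges \<open>\<rho>\<close> and
    \<open>\<sigma>\<close>; what stands under \<open>?f\<close> is then one step of
    \<open>Phi\<close> for the original coalgebra.\<close>
  also have "\<dots> = \<sigma> \<cdot> (?f \<rho> \<cdot> (?f (?g \<sigma>) \<cdot> (?f (?g (?f v)) \<cdot> (?f (Sch E K) \<cdot> ?r))))"
    by (simp add: reassoc[OF dist])
  also have "\<dots> = \<sigma> \<cdot> (?f (Phi E (Sch E K) v) \<cdot> ?r)"
    by (simp add: Phi_def tau_eq T.fmap_comp)
  finally show ?case
    by (simp add: v_def)
qed

end

theorem theorem6p3:
  fixes E :: "('o, 'm) setting" (structure) and K :: "('o, 'm) pcoalg"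
  assumes "setting E"
    and "is_pcoalg E K"
    and "\<exists>\<rho> \<sigma>.
           monotone_algebra E (Omega E) (leq E) (Ff E) \<rho> \<and>
           monotone_algebra E (Omega E) (leq E) (Tf E) \<sigma> \<and>
           EM_algebra E (Tf E) (eta E) (mu E) (Omega E) \<sigma> \<and>
           tau E = \<rho> \<cdot> fmap (Ff E) \<sigma> \<and>
           \<sigma> \<cdot> fmap (Tf E) \<rho> = \<rho> \<cdot> fmap (Ff E) \<sigma> \<cdot> dlaw E (Omega E) \<and>
           (\<forall>X\<in>Obj E. bot_arr E (fobj (Tf E) X) = \<sigma> \<cdot> fmap (Tf E) (bot_arr E X))"
    and "fmap (Tf E) (pair E (Id E (State K)) (obs E K)) \<cdot> iota E (obs E K)
         = rstrength E (Tf E) (stT E) (State K) (Obs K) \<cdot>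
           pair E (iota E (obs E K)) (Tbar_arr E (obs E K))"
  shows "value_of E K = value_of E (Bel E K)"
proof -
  from assms(3) obtain \<rho> \<sigma> where
    \<rho>: "\<rho> \<in> Hom E (fobj (Ff E) (Omega E)) (Omega E)"
    and \<sigma>: "EM_algebra E (Tf E) (eta E) (mu E) (Omega E) \<sigma>"
    and tau_eq: "tau E = \<rho> \<cdot> fmap (Ff E) \<sigma>"
    and dist: "\<sigma> \<cdot> fmap (Tf E) \<rho> = \<rho> \<cdot> fmap (Ff E) \<sigma> \<cdot> dlaw E (Omega E)"
    and bot: "\<forall>X\<in>Obj E. bot_arr E (fobj (Tf E) X) = \<sigma> \<cdot> fmap (Tf E) (bot_arr E X)"
    unfolding monotone_algebra_def by blast
  interpret pcoalgebra E K
    using assms(1,2) by (simp add: pcoalgebra_def pcoalgebra_axioms_def)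
  let ?w = "\<lambda>n. (Phi E (Sch E (Bel E K)) ^^ n) (bot_arr E (belief \<otimes> hist))"
  let ?v = "\<lambda>n. (Phi E (Sch E K) ^^ n) (bot_arr E (State K \<otimes> hist))"
  \<comment> \<open>Proved for each \<open>n\<close> and each initial history separately, so the two
    joins are over the same set. The arrow \<open>k\<close> stands for the transpose of
    \<open>u \<cdot> cons E (Obs K)\<close>.\<close>
  have eq: "?w n \<cdot> (\<langle>Id E belief, k \<cdot> belief_obs\<rangle> \<cdot> (eta_bar E (obs E K) \<cdot> point K))
      = ?v n \<cdot> (\<langle>Id E (State K), k \<cdot> obs E K\<rangle> \<cdot> point K)"
    if k: "k \<in> Hom E (Obs K) hist" for n k
  proof -
    have [simp]: "\<sigma> \<in> Arr E" "Dom E \<sigma> = fobj (Tf E) (Omega E)" "Cod E \<sigma> = Omega E" "Omega E \<in> Obj E"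
      using \<sigma> Omega by (simp_all add: EM_algebra_def ordered_object_def)
    have \<sigma>_eta: "\<sigma> \<cdot> eta E (Omega E) = Id E (Omega E)"
      using \<sigma> by (simp add: EM_algebra_def)
    let ?s = "\<langle>Id E (State K), k \<cdot> obs E K\<rangle> \<cdot> point K"
    \<comment> \<open>On a unit belief, \<open>\<iota>\<close> gives the monad unit and
      \<open>belief_obs\<close> the original observation, so both runs start with the same
      history.\<close>
    have "(\<iota> \<boxtimes> Id E hist) \<cdot> (\<langle>Id E belief, k \<cdot> belief_obs\<rangle> \<cdot> (eta_bar E (obs E K) \<cdot> point K))
        = (eta E (State K) \<boxtimes> Id E hist) \<cdot> ?s"
      using k by (simp add: cross_pair reassoc[OF eta_bar_simps(4)] reassoc[OF eta_bar_simps(5)])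
    then have "?w n \<cdot> (\<langle>Id E belief, k \<cdot> belief_obs\<rangle> \<cdot> (eta_bar E (obs E K) \<cdot> point K))
        = \<sigma> \<cdot> (fmap (Tf E) (?v n) \<cdot> (T.rst (State K) hist \<cdot> ((eta E (State K) \<boxtimes> Id E hist) \<cdot> ?s)))"
      unfolding Phi_Sch_Bel[OF assms(4) \<rho> \<sigma> tau_eq dist bot] using k by (simp del: pair_comp)
    \<comment> \<open>The strength of a unit is a unit by \<open>rst_eta\<close>, and naturality
      moves it past \<open>?v n\<close> to meet \<open>\<sigma>\<close>.\<close>
    also have "\<dots> = \<sigma> \<cdot> (eta E (Omega E) \<cdot> (?v n \<cdot> ?s))"
      using k by (simp del: pair_comp add: reassoc[OF rst_eta]
          reassoc[OF eta_natural[where X = "State K \<otimes> hist" and Y = "Omega E"]])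
    also have "\<dots> = ?v n \<cdot> ?s"
      using k by (simp del: pair_comp add: reassoc[OF \<sigma>_eta])
    finally show ?thesis .
  qed
  \<comment> \<open>Both sets are indexed by the same \<open>u\<close> and \<open>n\<close>, since
    \<open>Bel\<close> keeps the observation object.\<close>
  have "{?w n \<cdot> \<langle>Id E belief, curry E (Obs K) (star_obj E (Obs K)) (u \<cdot> cons E (Obs K)) \<cdot> belief_obs\<rangle> \<cdot>
           eta_bar E (obs E K) \<cdot> point K | u n. u \<in> Hom E (plus_obj E (Obs K)) (Act E)}
      = {?v n \<cdot> \<langle>Id E (State K), curry E (Obs K) (star_obj E (Obs K)) (u \<cdot> cons E (Obs K)) \<cdot> obs E K\<rangle> \<cdot>
           point K | u n. u \<in> Hom E (plus_obj E (Obs K)) (Act E)}"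
  proof -
    have "curry E (Obs K) (star_obj E (Obs K)) (u \<cdot> cons E (Obs K)) \<in> Hom E (Obs K) hist"
      if "u \<in> Hom E (plus_obj E (Obs K)) (Act E)" for u
      using that by simp
    then show ?thesis
      using eq by (metis (no_types, lifting))
  qed
  then show ?thesis
    by (simp only: value_of_def Let_def Bel_simps)
qed

end
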